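(* Let $V$ be a finite-dimensional complex vector space with basis $e_1,\dots,e_n$, and let $(M^{ab}, M_{ab}, R, \overline{R})$ be an unoriented quantum state model (as defined in the context) whose crossing operator is of swap form $R=(F\otimes G)\circ S$, with $F,G\in GL(V)$ and $S(x\otimes y)=y\otimes x$. Let $\mathrm{Invar}(K)$ denote its state sum. Then $\mathrm{Invar}$ produces only trivial invariants for knots (links of one component): if $K$ is a diagram of any knot and $U$ is a diagram of the unknot with the same writhe and the same Whitney degree as $K$ (for suitable orientations of $K$ and $U$), then $\mathrm{Invar}(K)=\mathrm{Invar}(U)$.
   Context: A Morse diagram is a link diagram in the plane in general position with respect to the vertical direction, so that it decomposes into minima (cups), maxima (caps) and crossings; every link diagram can be put in this form by a planar isotopy. An unoriented quantum state model consists of complex numbers $M^{ab}$ (attached to minima with upper left and upper right endpoints labelled $a,b$), $M_{ab}$ (attached to maxima with lower left and lower right endpoints $a,b$), an invertible operator $R$ on $V\otimes V$ with inverse $\overline R$ and entries given by $R(e_a\otimes e_b)=\sum_{c,d} R^{ab}_{cd}\,e_c\otimes e_d$, and similarly $\overline{R}^{ab}_{cd}$. At a crossing, $a,b$ label the upper left and upper right endpoints and $c,d$ the lower left and lower right endpoints; $R$ is attached to crossings whose overcrossing strand runs from upper left to lower right, and $\overline R$ to the other type of crossing. The following equations (repeated indices summed) are required: 1. $M_{ai}M^{ib}=\delta_a^b=M^{bi}M_{ia}$; 2. $\overline{R}^{ab}_{ij}R^{ij}_{cd}=\delta^a_c\delta^b_d=R^{ab}_{ij}\overline{R}^{ij}_{cd}$;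 3. the Yang-Baxter equation $(R\otimes I)(I\otimes R)(R\otimes I)=(I\otimes R)(R\otimes I)(I\otimes R)$; 4. $M^{di}\,\overline{R}^{ab}_{ic}=R^{da}_{ci}\,M^{ib}$ and $M_{di}\,\overline{R}^{ic}_{ab}=R^{ci}_{da}\,M_{ib}$, together with the same two equations with $R$ and $\overline{R}$ interchanged. The state sum of a Morse diagram $K$ is obtained by labelling the endpoints of all cups, caps and crossings by indices in $\{1,\dots,n\}$ (joined endpoints receiving the same label), taking the product of the corresponding entries, and summing over all labellings. Equations 1-4 make it an invariant of regular isotopy (the equivalence relation generated by planar isotopy and the second and third Reidemeister moves). The writhe is the sum of the signs of the crossings. The Whitney degree of an oriented knot diagram is the total turning number of the tangent vector of the underlying oriented immersed plane curve. Since the state sum is only a regular isotopy invariant, diagrams are compared when they have the same writhe and Whitney degree: two such knot diagrams are regularly isotopic if and only if they are ambient isotopic. *)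

theory Defs
  imports "HOL-Analysis.Analysis"
begin

section \<open>Morse diagrams\<close>

text \<open>
  A diagram in general position with respect to the vertical direction is recorded, from top to
  bottom, as the list of its elementary pieces.  The pair (p, i) is a horizontal slice consisting of
  the piece p with exactly i vertical strands to its left; all other strands run straight down.
  A word determines the diagram up to planar isotopies that keep the order of the heights of the
  pieces.

  At a crossing, Over means that the strand from upper left to lower right is the overcrossing
  strand, Under that it is the undercrossing strand.
\<close>

datatype piece = Cup | Cap | Over | Under

type_synonym slice = "piece \<times> nat"
type_synonym diagram = "slice list"

fun ins :: "piece \<Rightarrow> nat" where
  "ins Cup = 2"
| "ins Cap = 0"
| "ins Over = 2"
| "ins Under = 2"

fun outs :: "piece \<Rightarrow> nat" where
  "outs Cup = 0"
| "outs Cap = 2"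
| "outs Over = 2"
| "outs Under = 2"

text \<open>
  Level k lies just above the k-th slice (counted from 0), and level \<open>length D\<close> is the
  bottom of the diagram.
\<close>

definition strands :: "diagram \<Rightarrow> nat \<Rightarrow> nat" where
  "strands D k = foldl (\<lambda>m (p, i). m - ins p + outs p) 0 (take k D)"

definition morse_diagram :: "diagram \<Rightarrow> bool" where
  "morse_diagram D \<longleftrightarrow>
     (\<forall>k<length D. case D ! k of (p, i) \<Rightarrow> i + ins p \<le> strands D k) \<and>
     strands D (length D) = 0"

type_synonym point = "nat \<times> nat"

definition points :: "diagram \<Rightarrow> point set" where
  "points D = {(k, u). k \<le> length D \<and> u < strands D k}"

text \<open>
  Position u above the slice and position v below it are the ends of one of the vertical strands
  passing beside the piece.
\<close>

definition beside :: "slice \<Rightarrow> nat \<Rightarrow> nat \<Rightarrow> bool" where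
  "beside s u v \<longleftrightarrow> (case s of (p, i) \<Rightarrow>
     (u < i \<and> v = u) \<or> (\<exists>j\<ge>i. u = j + ins p \<and> v = j + outs p))"

definition verticals :: "diagram \<Rightarrow> (point \<times> point) set" where
  "verticals D = {((k, u), (Suc k, v)) | k u v.
     k < length D \<and> u < strands D k \<and> beside (D ! k) u v}"


section \<open>Components, orientations, writhe and Whitney degree\<close>

definition strand_steps :: "diagram \<Rightarrow> (point \<times> point) set" where
  "strand_steps D = verticals D
     \<union> {((k, i), (k, Suc i)) | k i. k < length D \<and> D ! k = (Cup, i)}
     \<union> {((Suc k, i), (Suc k, Suc i)) | k i. k < length D \<and> D ! k = (Cap, i)}
     \<union> {((k, i), (Suc k, Suc i)) | k i. k < length D \<and> D ! k \<in> {(Over, i), (Under, i)}}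
     \<union> {((k, Suc i), (Suc k, i)) | k i. k < length D \<and> D ! k \<in> {(Over, i), (Under, i)}}"

definition same_component :: "diagram \<Rightarrow> (point \<times> point) set" where
  "same_component D =
     {(x, y). x \<in> points D \<and> y \<in> points D \<and> (x, y) \<in> (strand_steps D \<union> (strand_steps D)\<inverse>)\<^sup>*}"

definition components :: "diagram \<Rightarrow> point set set" where
  "components D = points D // same_component D"

definition knot_diagram :: "diagram \<Rightarrow> bool" where
  "knot_diagram D \<longleftrightarrow> morse_diagram D \<and> card (components D) = 1"

text \<open>An orientation tells at which points of the diagram the strand is directed downwards.\<close>

definition orientation :: "diagram \<Rightarrow> (point \<Rightarrow> bool) \<Rightarrow> bool" where
  "orientation D down \<longleftrightarrow>
     (\<forall>(x, y)\<in>verticals D. down x = down y) \<and>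
     (\<forall>k<length D. case D ! k of
        (Cup, i) \<Rightarrow> down (k, i) \<noteq> down (k, Suc i)
      | (Cap, i) \<Rightarrow> down (Suc k, i) \<noteq> down (Suc k, Suc i)
      | (_, i) \<Rightarrow> down (k, i) = down (Suc k, Suc i) \<and> down (k, Suc i) = down (Suc k, i))"

text \<open>
  A crossing is positive iff the pair (overcrossing direction, undercrossing direction) is a
  positively oriented basis of the plane.  If both strands point down and the one from upper left
  crosses over, this basis is (1, -1), (-1, -1), which is negative; reversing one strand or
  exchanging over and under changes the sign.
\<close>

definition crossing_sign :: "diagram \<Rightarrow> (point \<Rightarrow> bool) \<Rightarrow> nat \<Rightarrow> int" where
  "crossing_sign D down k = (case D ! k of
      (Over, i) \<Rightarrow> if down (k, i) = down (k, Suc i) then -1 else 1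
    | (Under, i) \<Rightarrow> if down (k, i) = down (k, Suc i) then 1 else -1
    | _ \<Rightarrow> 0)"

definition writhe :: "diagram \<Rightarrow> (point \<Rightarrow> bool) \<Rightarrow> int" where
  "writhe D down = (\<Sum>k<length D. crossing_sign D down k)"

text \<open>
  The turning angle is the total (counterclockwise) rotation of the tangent vector within one slice,
  for the smooth drawing in which all strands are vertical at every level.  The two strands of a
  crossing then begin and end in the same direction and rotate by 0 in total, while a cup or a cap
  is a half turn, counterclockwise iff its left end is directed downwards.
\<close>

definition turning_angle :: "diagram \<Rightarrow> (point \<Rightarrow> bool) \<Rightarrow> nat \<Rightarrow> real" where
  "turning_angle D down k = (case D ! k of
      (Cup, i) \<Rightarrow> if down (k, i) then pi else - pi
    | (Cap, i) \<Rightarrow> if down (Suc k, i) then pi else - pi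
    | _ \<Rightarrow> 0)"

definition whitney_degree :: "diagram \<Rightarrow> (point \<Rightarrow> bool) \<Rightarrow> real" where
  "whitney_degree D down = (\<Sum>k<length D. turning_angle D down k) / (2 * pi)"


section \<open>Isotopy of Morse diagrams\<close>

text \<open>
  Planar isotopies of Morse diagrams are generated by exchanging the heights of two pieces that lie
  side by side, cancelling a maximum against a neighbouring minimum, and sliding a strand leading to
  a cup or cap across a crossing.
\<close>

inductive planar_move :: "diagram \<Rightarrow> diagram \<Rightarrow> bool" where
  exchange: "i \<le> j \<Longrightarrow> planar_move [(p, i), (q, j + outs p)] [(q, j + ins p), (p, i)]"
| zigzag1: "planar_move [(Cap, i), (Cup, Suc i)] []"
| zigzag2: "planar_move [(Cap, Suc i), (Cup, i)] []"
| cup_slide1: "planar_move [(Under, Suc i), (Cup, i)] [(Over, i), (Cup, Suc i)]"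
| cup_slide2: "planar_move [(Over, Suc i), (Cup, i)] [(Under, i), (Cup, Suc i)]"
| cap_slide1: "planar_move [(Cap, i), (Under, Suc i)] [(Cap, Suc i), (Over, i)]"
| cap_slide2: "planar_move [(Cap, i), (Over, Suc i)] [(Cap, Suc i), (Under, i)]"

inductive reidemeister_move :: "diagram \<Rightarrow> diagram \<Rightarrow> bool" where
  I_cap: "p \<in> {Over, Under} \<Longrightarrow> reidemeister_move [(Cap, i), (p, i)] [(Cap, i)]"
| I_cup: "p \<in> {Over, Under} \<Longrightarrow> reidemeister_move [(p, i), (Cup, i)] [(Cup, i)]"
| II1: "reidemeister_move [(Over, i), (Under, i)] []"
| II2: "reidemeister_move [(Under, i), (Over, i)] []"
| III: "reidemeister_move [(Over, i), (Over, Suc i), (Over, i)] [(Over, Suc i), (Over, i), (Over, Suc i)]"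

definition local_change :: "diagram \<Rightarrow> diagram \<Rightarrow> bool" where
  "local_change D E \<longleftrightarrow> morse_diagram D \<and> morse_diagram E \<and>
     (\<exists>A B x y. D = A @ x @ B \<and> E = A @ y @ B \<and> (planar_move x y \<or> reidemeister_move x y))"

definition ambient_isotopic :: "diagram \<Rightarrow> diagram \<Rightarrow> bool" where
  "ambient_isotopic = equivclp local_change"

text \<open>
  The reference diagram is the round circle: one maximum above one minimum.
\<close>

definition unknot_diagram :: "diagram \<Rightarrow> bool" where
  "unknot_diagram D \<longleftrightarrow> morse_diagram D \<and> ambient_isotopic D [(Cap, 0), (Cup, 0)]"


section \<open>Unoriented quantum state models\<close>

text \<open>
  V is the space \<open>complex ^ 'n\<close> with standard basis indexed by \<open>'n\<close>, and the tensor square of V is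
  \<open>complex ^ ('n \<times> 'n)\<close>, where the tensor product of the a-th and the b-th basis vector is the
  basis vector with index (a, b).  Operators are matrices acting on column vectors, so that the
  image of the basis vector with index (a, b) is column (a, b).
\<close>

record 'n state_model =
  M_cup :: "complex ^ 'n ^ 'n"
  M_cap :: "complex ^ 'n ^ 'n"
  R_op :: "complex ^ ('n \<times> 'n) ^ ('n \<times> 'n)"
  Rbar_op :: "complex ^ ('n \<times> 'n) ^ ('n \<times> 'n)"

definition ent :: "complex ^ ('n::finite \<times> 'n) ^ ('n \<times> 'n) \<Rightarrow> 'n \<Rightarrow> 'n \<Rightarrow> 'n \<Rightarrow> 'n \<Rightarrow> complex" where
  "ent T a b c d = T $ (c, d) $ (a, b)"

definition tensor_op ::
  "complex ^ ('n::finite) ^ 'n \<Rightarrow> complex ^ 'n ^ 'n \<Rightarrow> complex ^ ('n \<times> 'n) ^ ('n \<times> 'n)" where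
  "tensor_op A B = (\<chi> x y. A $ fst x $ fst y * B $ snd x $ snd y)"

definition swap_op :: "complex ^ ('n::finite \<times> 'n) ^ ('n \<times> 'n)" where
  "swap_op = (\<chi> x y. if x = prod.swap y then 1 else 0)"

text \<open>The operators T \<open>\<otimes>\<close> I and I \<open>\<otimes>\<close> T on the tensor cube of V.\<close>

definition op12 :: "complex ^ ('n::finite \<times> 'n) ^ ('n \<times> 'n) \<Rightarrow>
    complex ^ ('n \<times> 'n \<times> 'n) ^ ('n \<times> 'n \<times> 'n)" where
  "op12 T = (\<chi> x y. case (x, y) of ((c1, c2, c3), (a1, a2, a3)) \<Rightarrow>
     T $ (c1, c2) $ (a1, a2) * (if c3 = a3 then 1 else 0))"

definition op23 :: "complex ^ ('n::finite \<times> 'n) ^ ('n \<times> 'n) \<Rightarrow>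
    complex ^ ('n \<times> 'n \<times> 'n) ^ ('n \<times> 'n \<times> 'n)" where
  "op23 T = (\<chi> x y. case (x, y) of ((c1, c2, c3), (a1, a2, a3)) \<Rightarrow>
     (if c1 = a1 then 1 else 0) * T $ (c2, c3) $ (a2, a3))"

definition yang_baxter :: "complex ^ ('n::finite \<times> 'n) ^ ('n \<times> 'n) \<Rightarrow> bool" where
  "yang_baxter T \<longleftrightarrow> op12 T ** op23 T ** op12 T = op23 T ** op12 T ** op23 T"

definition slide_equations ::
  "'n::finite state_model \<Rightarrow> complex ^ ('n \<times> 'n) ^ ('n \<times> 'n) \<Rightarrow> complex ^ ('n \<times> 'n) ^ ('n \<times> 'n) \<Rightarrow> bool" where
  "slide_equations Q T Tbar \<longleftrightarrow>
     (\<forall>a b c d. (\<Sum>i\<in>UNIV. M_cup Q $ d $ i * ent Tbar a b i c)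
              = (\<Sum>i\<in>UNIV. ent T d a c i * M_cup Q $ i $ b)) \<and>
     (\<forall>a b c d. (\<Sum>i\<in>UNIV. M_cap Q $ d $ i * ent Tbar i c a b)
              = (\<Sum>i\<in>UNIV. ent T c i d a * M_cap Q $ i $ b))"

definition unoriented_quantum_state_model :: "'n::finite state_model \<Rightarrow> bool" where
  "unoriented_quantum_state_model Q \<longleftrightarrow>
     (\<forall>a b. (\<Sum>i\<in>UNIV. M_cap Q $ a $ i * M_cup Q $ i $ b) = (if a = b then 1 else 0)) \<and>
     (\<forall>a b. (\<Sum>i\<in>UNIV. M_cup Q $ b $ i * M_cap Q $ i $ a) = (if a = b then 1 else 0)) \<and>
     (\<forall>a b c d. (\<Sum>i\<in>UNIV. \<Sum>j\<in>UNIV. ent (Rbar_op Q) a b i j * ent (R_op Q) i j c d)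
              = (if a = c \<and> b = d then 1 else 0)) \<and>
     (\<forall>a b c d. (\<Sum>i\<in>UNIV. \<Sum>j\<in>UNIV. ent (R_op Q) a b i j * ent (Rbar_op Q) i j c d)
              = (if a = c \<and> b = d then 1 else 0)) \<and>
     yang_baxter (R_op Q) \<and>
     slide_equations Q (R_op Q) (Rbar_op Q) \<and>
     slide_equations Q (Rbar_op Q) (R_op Q)"


section \<open>The state sum\<close>

text \<open>
  Every point of the diagram receives a label, the two ends of a vertical strand the same one; being
  extensional, labellings are undefined outside the points, which makes their number finite.
\<close>

definition labellings :: "diagram \<Rightarrow> (point \<Rightarrow> 'n) set" where
  "labellings D = {l \<in> points D \<rightarrow>\<^sub>E UNIV. \<forall>(x, y)\<in>verticals D. l x = l y}"

definition weight :: "'n::finite state_model \<Rightarrow> diagram \<Rightarrow> (point \<Rightarrow> 'n) \<Rightarrow> nat \<Rightarrow> complex" where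
  "weight Q D l k = (case D ! k of
      (Cup, i) \<Rightarrow> M_cup Q $ l (k, i) $ l (k, Suc i)
    | (Cap, i) \<Rightarrow> M_cap Q $ l (Suc k, i) $ l (Suc k, Suc i)
    | (Over, i) \<Rightarrow> ent (R_op Q) (l (k, i)) (l (k, Suc i)) (l (Suc k, i)) (l (Suc k, Suc i))
    | (Under, i) \<Rightarrow> ent (Rbar_op Q) (l (k, i)) (l (k, Suc i)) (l (Suc k, i)) (l (Suc k, Suc i)))"

definition Invar :: "'n::finite state_model \<Rightarrow> diagram \<Rightarrow> complex" where
  "Invar Q D = (\<Sum>l\<in>labellings D. \<Prod>k<length D. weight Q D l k)"

end

theory Submission
  imports Defs "HOL-Combinatorics.Orbits"
begin

text \<open>
  An operator of the form \<open>R = (F \<otimes> G) \<circ> S\<close> lets the two strands of a crossing pass through each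
  other: the undercrossing strand is multiplied by \<open>F\<close> or its inverse, the overcrossing one by \<open>G\<close> or
  its inverse. Labels therefore interact only along strands, and the state sum of a knot is the
  trace of one product of matrices, collected while running once around the knot
  (\<open>Invar_transport\<close>, \<open>path_sum\<close>).

  The value of this product does not depend on the order of its factors. Write \<open>N\<close> for the matrix of
  the minima and \<open>P\<close>, its inverse, for that of the maxima. The slide equations compare pure tensors, and a pure tensor
  determines its factors up to a scalar; so they yield scalars with \<open>F\<inverse> = lam F\<close>,
  \<open>G\<inverse> = mu G\<close> and, for \<open>eps = lam mu\<close>, the relations \<open>F\<^sup>T N = eps N F\<close>, \<open>G\<^sup>T N = eps N G\<close>,
  \<open>eps\<^sup>2 = 1\<close> (\<open>swap_state_modelI\<close>). Thus if the spaces on downward strands are identified with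
  those on upward strands by means of \<open>N\<close>, a passage in either direction contributes \<open>F\<close> or \<open>G\<close> up
  to a scalar (\<open>transport_gauge\<close>). The Yang-Baxter equation says that \<open>F\<close> and \<open>G\<close> commute, and both
  commute with the matrix \<open>T = P N\<^sup>T\<close> of a full turn. The whole product is therefore determined by the
  number of its factors of each kind.

  Counting them crossing by crossing, a negative crossing contributes \<open>F G\<close> and a positive one
  \<open>eps F G\<close>, and these are inverse to each other; full turns in opposite directions contribute
  inverse matrices as well. What is left is the trace of a product of a power of \<open>F G\<close> fixed by the
  writhe and a power of \<open>T\<close> fixed by the Whitney degree (\<open>Invar_formula\<close>).

  The formula holds for all diagrams with one component, so it has to be seen that a diagram of the
  unknot has one component. This follows by counting the colourings of the strands with two
  colours: their number is unchanged by all planar and Reidemeister moves and is 2 for the circle,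
  whereas a diagram with at least two components has at least three of them
  (\<open>unknot_connected\<close>).
\<close>

section \<open>Following the strands of an oriented diagram\<close>

locale oriented_diagram =
  fixes D :: diagram and down :: "point \<Rightarrow> bool"
  assumes morse: "morse_diagram D" and orient: "orientation D down"
begin

lemma strands_0 [simp]: "strands D 0 = 0"
  by (simp add: strands_def)

lemma strands_end [simp]: "strands D (length D) = 0"
  using morse by (simp add: morse_diagram_def)

lemma strands_Suc:
  "k < length D \<Longrightarrow> D ! k = (p, i) \<Longrightarrow> strands D (Suc k) = strands D k - ins p + outs p"
  by (simp add: strands_def take_Suc_conv_app_nth)

lemma slice_fits: "k < length D \<Longrightarrow> D ! k = (p, i) \<Longrightarrow> i + ins p \<le> strands D k"
  using morse unfolding morse_diagram_def by fastforce

lemma finite_points: "finite (points D)"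
proof (rule finite_subset)
  show "points D \<subseteq> Sigma {..length D} (\<lambda>k. {..<strands D k})"
    by (auto simp: points_def)
qed simp

lemma point_below: "(k, u) \<in> points D \<Longrightarrow> k < length D"
  by (cases "k = length D") (auto simp: points_def)

lemma point_above: "(k, u) \<in> points D \<Longrightarrow> \<exists>k'. k = Suc k' \<and> k' < length D"
  by (cases k) (auto simp: points_def)

lemma vertical_iff: "k < length D \<Longrightarrow> D ! k = (p, i) \<Longrightarrow> ((k, u), y) \<in> verticals D \<longleftrightarrow>
   u < strands D k \<and> (u < i \<and> y = (Suc k, u) \<or> i + ins p \<le> u \<and> y = (Suc k, u - ins p + outs p))"
  unfolding verticals_def beside_def
  by (auto simp: le_iff_add)

lemma down_vertical: "(x, y) \<in> verticals D \<Longrightarrow> down y = down x"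
  using orient unfolding orientation_def by fastforce

lemma down_cup: "k < length D \<Longrightarrow> D ! k = (Cup, i) \<Longrightarrow> down (k, Suc i) \<longleftrightarrow> \<not> down (k, i)"
  and down_cap: "k < length D \<Longrightarrow> D ! k = (Cap, i) \<Longrightarrow> down (Suc k, Suc i) \<longleftrightarrow> \<not> down (Suc k, i)"
  using orient unfolding orientation_def by fastforce+

lemma down_crossing:
  assumes "k < length D" "D ! k = (p, i)" "p = Over \<or> p = Under"
  shows "down (Suc k, Suc i) = down (k, i)" "down (Suc k, i) = down (k, Suc i)"
  using orient assms unfolding orientation_def by fastforce+

lemma down_left:
  assumes "k < length D" "D ! k = (p, i)" "u < i"
  shows "down (Suc k, u) = down (k, u)"
proof -
  have "((k, u), (Suc k, u)) \<in> verticals D"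
    using assms slice_fits[of k p i] by (simp add: vertical_iff)
  thus ?thesis by (rule down_vertical)
qed

lemma down_right:
  assumes "k < length D" "D ! k = (p, i)" "i \<le> j" "j + ins p < strands D k"
  shows "down (Suc k, j + outs p) = down (k, j + ins p)"
proof -
  have "((k, j + ins p), (Suc k, j + outs p)) \<in> verticals D"
    using assms by (simp add: vertical_iff)
  thus ?thesis by (rule down_vertical)
qed

text \<open>
  Following the strand through the slice below, respectively above, a point. Inside a piece at
  position \<open>i\<close> the ends \<open>i\<close> and \<open>i + 1\<close> are exchanged, which is \<open>u \<mapsto> 2 i + 1 - u\<close>.
\<close>

definition next_below :: "point \<Rightarrow> point" where
  "next_below x = (case x of (k, u) \<Rightarrow> case D ! k of (p, i) \<Rightarrow>
     if u < i then (Suc k, u) else if i + ins p \<le> u then (Suc k, u - ins p + outs p)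
     else if p = Cup then (k, 2 * i + 1 - u) else (Suc k, 2 * i + 1 - u))"

definition next_above :: "point \<Rightarrow> point" where
  "next_above x = (case x of (k, u) \<Rightarrow> case D ! (k - 1) of (p, i) \<Rightarrow>
     if u < i then (k - 1, u) else if i + outs p \<le> u then (k - 1, u - outs p + ins p)
     else if p = Cap then (k, 2 * i + 1 - u) else (k - 1, 2 * i + 1 - u))"

text \<open>
  One step along the orientation. Outside the points it is the identity, which makes it a permutation
  of the whole type.
\<close>

definition succ :: "point \<Rightarrow> point" where
  "succ x = (if x \<in> points D then if down x then next_below x else next_above x else x)"

definition pred :: "point \<Rightarrow> point" where
  "pred x = (if down x then next_above x else next_below x)"

lemma cases_below:
  assumes "(k, u) \<in> points D"
  obtains (left) p i where "k < length D" "D ! k = (p, i)" "u < i" "u < strands D k" "u < strands D (Suc k)"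
     "i + ins p \<le> strands D k"
  | (right) p i j where "k < length D" "D ! k = (p, i)" "u = j + ins p" "i \<le> j" 
     "j + ins p < strands D k" "j + outs p < strands D (Suc k)" "i + ins p \<le> strands D k"
  | (inside) p i where "k < length D" "D ! k = (p, i)" "p \<noteq> Cap" "u = i \<or> u = Suc i"
     "i + ins p \<le> strands D k" "i + outs p \<le> strands D (Suc k)"
proof -
  obtain p i where D: "D ! k = (p, i)" by force
  have k: "k < length D" using assms by (rule point_below)
  note f = slice_fits[OF k D] strands_Suc[OF k D]
  have u: "u < strands D k" using assms by (simp add: points_def)
  consider "u < i" | "i + ins p \<le> u" | "i \<le> u" "u < i + ins p" by linarith
  thus thesis
  proof cases
    case 1 thus ?thesis using left[OF k D] f u by simp
  next
    case 2 thus ?thesis using right[OF k D, of "u - ins p"] f u by auto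
  next
    case 3
    have "p \<noteq> Cap" "u = i \<or> u = Suc i" using 3 by (cases p; simp; linarith)+
    moreover have "i + outs p \<le> strands D (Suc k)" using f by linarith
    ultimately show ?thesis using inside[OF k D] f by blast
  qed
qed

lemma cases_above:
  assumes "(m, u) \<in> points D"
  obtains (left) k p i where "m = Suc k" "k < length D" "D ! k = (p, i)" "u < i" "u < strands D k" "u < strands D (Suc k)"
     "i + ins p \<le> strands D k"
  | (right) k p i j where "m = Suc k" "k < length D" "D ! k = (p, i)" "u = j + outs p" "i \<le> j" 
     "j + ins p < strands D k" "j + outs p < strands D (Suc k)" "i + ins p \<le> strands D k"
  | (inside) k p i where "m = Suc k" "k < length D" "D ! k = (p, i)" "p \<noteq> Cup" "u = i \<or> u = Suc i"
     "i + ins p \<le> strands D k" "i + outs p \<le> strands D (Suc k)"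
proof -
  obtain k where m: "m = Suc k" and k: "k < length D" using point_above[OF assms] by auto
  obtain p i where D: "D ! k = (p, i)" by force
  note f = slice_fits[OF k D] strands_Suc[OF k D]
  have u: "u < strands D (Suc k)" using assms m by (simp add: points_def)
  consider "u < i" | "i + outs p \<le> u" | "i \<le> u" "u < i + outs p" by linarith
  thus thesis
  proof cases
    case 1 thus ?thesis using left[OF m k D] f u by simp
  next
    case 2 thus ?thesis using right[OF m k D, of "u - outs p"] f u by auto
  next
    case 3
    have "p \<noteq> Cup" "u = i \<or> u = Suc i" using 3 by (cases p; simp; linarith)+
    moreover have "i + outs p \<le> strands D (Suc k)" using f by linarith
    ultimately show ?thesis using inside[OF m k D] f by blast
  qed
qed

lemma pointI: "k \<le> length D \<Longrightarrow> u < strands D k \<Longrightarrow> (k, u) \<in> points D"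
  by (simp add: points_def)

lemma next_below_left: "D ! k = (p, i) \<Longrightarrow> u < i \<Longrightarrow> next_below (k, u) = (Suc k, u)"
  and next_below_right: "D ! k = (p, i) \<Longrightarrow> i \<le> j \<Longrightarrow> next_below (k, j + ins p) = (Suc k, j + outs p)"
  and next_below_cup: "D ! k = (Cup, i) \<Longrightarrow> next_below (k, i) = (k, Suc i)"
    "D ! k = (Cup, i) \<Longrightarrow> next_below (k, Suc i) = (k, i)"
  and next_below_crossing: "D ! k = (p, i) \<Longrightarrow> p = Over \<or> p = Under \<Longrightarrow> next_below (k, i) = (Suc k, Suc i)"
    "D ! k = (p, i) \<Longrightarrow> p = Over \<or> p = Under \<Longrightarrow> next_below (k, Suc i) = (Suc k, i)"
  by (auto simp: next_below_def)

lemma next_above_left: "D ! k = (p, i) \<Longrightarrow> u < i \<Longrightarrow> next_above (Suc k, u) = (k, u)"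
  and next_above_right: "D ! k = (p, i) \<Longrightarrow> i \<le> j \<Longrightarrow> next_above (Suc k, j + outs p) = (k, j + ins p)"
  and next_above_cap: "D ! k = (Cap, i) \<Longrightarrow> next_above (Suc k, i) = (Suc k, Suc i)"
    "D ! k = (Cap, i) \<Longrightarrow> next_above (Suc k, Suc i) = (Suc k, i)"
  and next_above_crossing: "D ! k = (p, i) \<Longrightarrow> p = Over \<or> p = Under \<Longrightarrow> next_above (Suc k, i) = (k, Suc i)"
    "D ! k = (p, i) \<Longrightarrow> p = Over \<or> p = Under \<Longrightarrow> next_above (Suc k, Suc i) = (k, i)"
  by (auto simp: next_above_def)

lemmas next_simps = next_below_left next_below_right next_below_cup next_below_crossing
  next_above_left next_above_right next_above_cap next_above_crossing

lemma next_below_pred: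
  assumes "(k, u) \<in> points D" "down (k, u)"
  shows "next_below (k, u) \<in> points D \<and> pred (next_below (k, u)) = (k, u)"
  using assms(1)
proof (cases rule: cases_below)
  case (left p i)
  then show ?thesis using assms(2) down_left[of k p i u]
    by (simp add: pred_def next_simps pointI)
next
  case (right p i j)
  then show ?thesis using assms(2) down_right[of k p i j]
    by (simp add: pred_def next_simps pointI)
next
  case (inside p i)
  then consider "p = Cup" | "p = Over \<or> p = Under" by (cases p) auto
  then show ?thesis
  proof cases
    case 1
    with inside assms(2) down_cup[of k i] show ?thesis
      by (elim disjE) (simp_all add: pred_def next_simps pointI)
  next
    case 2
    with inside assms(2) down_crossing[OF inside(1,2) 2] show ?thesis
      by (elim disjE) (simp_all add: pred_def next_simps pointI)
  qed
qed

lemma next_above_pred: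
  assumes "(m, u) \<in> points D" "\<not> down (m, u)"
  shows "next_above (m, u) \<in> points D \<and> pred (next_above (m, u)) = (m, u)"
  using assms(1)
proof (cases rule: cases_above)
  case (left k p i)
  then show ?thesis using assms(2) down_left[of k p i u]
    by (simp add: pred_def next_simps pointI)
next
  case (right k p i j)
  then show ?thesis using assms(2) down_right[of k p i j]
    by (simp add: pred_def next_simps pointI)
next
  case (inside k p i)
  then consider "p = Cap" | "p = Over \<or> p = Under" by (cases p) auto
  then show ?thesis
  proof cases
    case 1
    with inside assms(2) down_cap[of k i] show ?thesis
      by (elim disjE) (simp_all add: pred_def next_simps pointI)
  next
    case 2
    with inside assms(2) down_crossing[OF inside(2,3) 2] show ?thesis
      by (elim disjE) (simp_all add: pred_def next_simps pointI)
  qed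
qed

lemma succ_in_points: "x \<in> points D \<Longrightarrow> succ x \<in> points D"
  and pred_succ: "x \<in> points D \<Longrightarrow> pred (succ x) = x"
  using next_below_pred next_above_pred by (cases x, simp add: succ_def)+

lemma verticalE:
  assumes "(x, y) \<in> verticals D"
  obtains (left) k p i u where "x = (k, u)" "y = (Suc k, u)" "k < length D" "D ! k = (p, i)" "u < i"
     "u < strands D k" "u < strands D (Suc k)"
  | (right) k p i j where "x = (k, j + ins p)" "y = (Suc k, j + outs p)" "k < length D" "D ! k = (p, i)" "i \<le> j"
     "j + ins p < strands D k" "j + outs p < strands D (Suc k)"
proof -
  obtain k u v where *: "x = (k, u)" "y = (Suc k, v)" "k < length D" "u < strands D k" "beside (D ! k) u v"
    using assms by (auto simp: verticals_def)
  obtain p i where D: "D ! k = (p, i)" by force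
  note f = slice_fits[OF *(3) D] strands_Suc[OF *(3) D]
  show thesis using * f D left[of k u p i] right[of k _ p i] unfolding beside_def by auto
qed

lemma vertical_points: "(x, y) \<in> verticals D \<Longrightarrow> x \<in> points D \<and> y \<in> points D"
  by (erule verticalE) (auto intro!: pointI)

lemma vertical_succ: "(x, y) \<in> verticals D \<Longrightarrow> if down x then succ x = y else succ y = x"
proof -
  assume v: "(x, y) \<in> verticals D"
  note vertical_points[OF v] down_vertical[OF v]
  with v show ?thesis
    by (elim verticalE) (auto simp: succ_def next_below_def next_above_def)
qed

lemma strand_stepsE:
  assumes "(x, y) \<in> strand_steps D"
  obtains "(x, y) \<in> verticals D"
    | k i where "x = (k, i)" "y = (k, Suc i)" "k < length D" "D ! k = (Cup, i)"
    | k i where "x = (Suc k, i)" "y = (Suc k, Suc i)" "k < length D" "D ! k = (Cap, i)"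
    | k i p where "x = (k, i)" "y = (Suc k, Suc i)" "k < length D" "D ! k = (p, i)" "p = Over \<or> p = Under"
    | k i p where "x = (k, Suc i)" "y = (Suc k, i)" "k < length D" "D ! k = (p, i)" "p = Over \<or> p = Under"
  using assms unfolding strand_steps_def by blast

lemma slice_points:
  assumes "k < length D" "D ! k = (p, i)"
  shows "ins p = 2 \<Longrightarrow> (k, i) \<in> points D" "ins p = 2 \<Longrightarrow> (k, Suc i) \<in> points D"
    "outs p = 2 \<Longrightarrow> (Suc k, i) \<in> points D" "outs p = 2 \<Longrightarrow> (Suc k, Suc i) \<in> points D"
  using assms slice_fits[of k p i] strands_Suc[of k p i] by (auto intro!: pointI)

lemma steps_points:
  assumes "(x, y) \<in> strand_steps D"
  shows "x \<in> points D \<and> y \<in> points D"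
  using assms
proof (cases rule: strand_stepsE)
  case 1 thus ?thesis by (rule vertical_points)
qed (use slice_points in fastforce)+

text \<open>
  This links components, which are generated by undirected steps, to the orbits of \<open>succ\<close>.
\<close>

lemma steps_succ: "(x, y) \<in> strand_steps D \<Longrightarrow> y = succ x \<or> x = succ y"
proof -
  assume s: "(x, y) \<in> strand_steps D"
  note p = steps_points[OF s]
  show ?thesis
    using s
  proof (cases rule: strand_stepsE)
    case 1
    then show ?thesis using vertical_succ by metis
  next
    case (2 k i)
    with p down_cup[of k i] show ?thesis by (simp add: succ_def next_simps)
  next
    case (3 k i)
    with p down_cap[of k i] show ?thesis by (simp add: succ_def next_simps)
  next
    case (4 k i q)
    with p down_crossing[of k q i] show ?thesis by (simp add: succ_def next_simps)
  next
    case (5 k i q)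
    with p down_crossing[of k q i] show ?thesis by (simp add: succ_def next_simps)
  qed
qed

text \<open>
  The slice crossed by the step from \<open>x\<close> to \<open>succ x\<close>. Every step crosses exactly one slice, so that
  products over all points can be regrouped into products over slices.
\<close>

definition slice_of :: "point \<Rightarrow> nat" where
  "slice_of x = (if down x then fst x else fst x - 1)"

text \<open>
  The piece through which the strand leaves a point, and whether it enters that piece at the left end;
  \<open>None\<close> stands for a vertical strand.
\<close>

definition place :: "point \<Rightarrow> (piece \<times> bool) option" where
  "place x = (case D ! slice_of x of (p, i) \<Rightarrow>
     if i \<le> snd x \<and> snd x < i + (if down x then ins p else outs p) then Some (p, snd x = i) else None)"

definition starts :: "nat \<Rightarrow> point set" where
  "starts k = {x \<in> points D. slice_of x = k}"

definition piece_starts :: "nat \<Rightarrow> point set" where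
  "piece_starts k = {x \<in> starts k. place x \<noteq> None}"

lemma finite_starts: "finite (starts k)"
  using finite_points by (simp add: starts_def)

lemma slice_of_less: "x \<in> points D \<Longrightarrow> slice_of x < length D"
  using point_below[of "fst x" "snd x"] point_above[of "fst x" "snd x"]
  by (auto simp: slice_of_def)

lemma points_eq_starts: "points D = (\<Union>k<length D. starts k)"
  using slice_of_less by (auto simp: starts_def)

lemma prod_points: "prod h (points D) = (\<Prod>k<length D. prod h (starts k))"
  unfolding points_eq_starts
  by (rule prod.UNION_disjoint) (auto simp: finite_starts, auto simp: starts_def)

lemma sum_points: "sum h (points D) = (\<Sum>k<length D. sum h (starts k))"
  unfolding points_eq_starts
  by (rule sum.UNION_disjoint) (auto simp: finite_starts, auto simp: starts_def)

lemma piece_starts_iff: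
  assumes "k < length D" "D ! k = (p, i)"
  shows "x \<in> piece_starts k \<longleftrightarrow>
    (\<exists>u. x = (k, u) \<and> down x \<and> i \<le> u \<and> u < i + ins p) \<or>
    (\<exists>u. x = (Suc k, u) \<and> \<not> down x \<and> i \<le> u \<and> u < i + outs p)" (is "_ = ?r")
proof
  assume x: "x \<in> piece_starts k"
  obtain m u where mu: "x = (m, u)" by force
  have p: "(m, u) \<in> points D" using x mu by (simp add: piece_starts_def starts_def)
  show ?r
  proof (cases "down x")
    case True
    thus ?thesis using x assms mu by (auto simp: piece_starts_def starts_def slice_of_def place_def split: if_splits)
  next
    case False
    moreover obtain m' where "m = Suc m'" using point_above[OF p] by auto
    ultimately show ?thesis using x assms mu by (auto simp: piece_starts_def starts_def slice_of_def place_def split: if_splits)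
  qed
next
  assume ?r
  thus "x \<in> piece_starts k"
    using assms slice_fits[OF assms] strands_Suc[OF assms]
    by (auto simp: piece_starts_def starts_def slice_of_def place_def intro!: pointI)
qed

lemma two_positions: "i \<le> u \<and> u < Suc (Suc i) \<longleftrightarrow> u = i \<or> u = Suc i" for i u :: nat
  by auto

lemma piece_starts_cup:
  assumes "k < length D" "D ! k = (Cup, i)"
  shows "piece_starts k = {if down (k, i) then (k, i) else (k, Suc i)}"
proof -
  have "x \<in> piece_starts k \<longleftrightarrow> x = (k, i) \<and> down (k, i) \<or> x = (k, Suc i) \<and> down (k, Suc i)" for x
    unfolding piece_starts_iff[OF assms] by (auto simp: two_positions)
  with down_cup[OF assms] show ?thesis by (intro set_eqI) simp
qed

lemma piece_starts_cap:
  assumes "k < length D" "D ! k = (Cap, i)"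
  shows "piece_starts k = {if down (Suc k, i) then (Suc k, Suc i) else (Suc k, i)}"
proof -
  have "x \<in> piece_starts k \<longleftrightarrow>
      x = (Suc k, i) \<and> \<not> down (Suc k, i) \<or> x = (Suc k, Suc i) \<and> \<not> down (Suc k, Suc i)" for x
    unfolding piece_starts_iff[OF assms] by (auto simp: two_positions)
  with down_cap[OF assms] show ?thesis by (intro set_eqI) simp
qed

lemma piece_starts_crossing:
  assumes "k < length D" "D ! k = (p, i)" "p = Over \<or> p = Under"
  shows "piece_starts k = {if down (k, i) then (k, i) else (Suc k, Suc i),
                           if down (k, Suc i) then (k, Suc i) else (Suc k, i)}"
proof -
  have two: "ins p = Suc (Suc 0)" "outs p = Suc (Suc 0)" using assms(3) by auto
  have "x \<in> piece_starts k \<longleftrightarrow>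
      x = (k, i) \<and> down (k, i) \<or> x = (k, Suc i) \<and> down (k, Suc i) \<or>
      x = (Suc k, i) \<and> \<not> down (Suc k, i) \<or> x = (Suc k, Suc i) \<and> \<not> down (Suc k, Suc i)" for x
    unfolding piece_starts_iff[OF assms(1,2)] two by (auto simp: two_positions)
  with down_crossing[OF assms] show ?thesis by (intro set_eqI) auto
qed

lemma place_cup:
  assumes "k < length D" "D ! k = (Cup, i)"
  shows "down (k, i) \<Longrightarrow> place (k, i) = Some (Cup, True)"
    "\<not> down (k, i) \<Longrightarrow> place (k, Suc i) = Some (Cup, False)"
  using assms down_cup[OF assms] by (auto simp: place_def slice_of_def)

lemma place_cap:
  assumes "k < length D" "D ! k = (Cap, i)"
  shows "\<not> down (Suc k, i) \<Longrightarrow> place (Suc k, i) = Some (Cap, True)"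
    "down (Suc k, i) \<Longrightarrow> place (Suc k, Suc i) = Some (Cap, False)"
  using assms down_cap[OF assms] by (auto simp: place_def slice_of_def)

lemma place_crossing:
  assumes "k < length D" "D ! k = (p, i)" "p = Over \<or> p = Under"
  shows "down (k, i) \<Longrightarrow> place (k, i) = Some (p, True)"
    "down (k, Suc i) \<Longrightarrow> place (k, Suc i) = Some (p, False)"
    "\<not> down (k, i) \<Longrightarrow> place (Suc k, Suc i) = Some (p, False)"
    "\<not> down (k, Suc i) \<Longrightarrow> place (Suc k, i) = Some (p, True)"
  using assms down_crossing[OF assms] by (auto simp: place_def slice_of_def)

lemma starts_vertical:
  assumes "x \<in> starts k" "place x = None"
  shows "if down x then fst x = k \<and> (x, succ x) \<in> verticals D
    else fst (succ x) = k \<and> (succ x, x) \<in> verticals D"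
proof -
  obtain m u where x: "x = (m, u)" by force
  have p: "(m, u) \<in> points D" "x \<in> points D" and k: "slice_of x = k" using assms x by (auto simp: starts_def)
  have v: "(a, b) \<in> verticals D" if "a = (k', u')" "b = (Suc k', v')" "k' < length D"  "D ! k' = (q, i')"
    "u' < strands D k'" "u' < i' \<and> v' = u' \<or> (\<exists>j\<ge>i'. u' = j + ins q \<and> v' = j + outs q)" for a b k' u' v' i' q
    using that by (auto simp: vertical_iff)
  show ?thesis
  proof (cases "down x")
    case d: True
    then have mk: "m = k" using k x by (simp add: slice_of_def)
    from p(1) show ?thesis
    proof (cases rule: cases_below)
      case (left q i)
      with d p mk x show ?thesis by (auto simp: succ_def next_simps intro!: v)
    next
      case (right q i j)
      with d p mk x show ?thesis by (auto simp: succ_def next_simps intro!: v)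
    next
      case (inside q i)
      then have "ins q = 2" by (cases q) auto
      with inside assms(2) d x mk show ?thesis by (auto simp: place_def slice_of_def)
    qed
  next
    case d: False
    from p(1) show ?thesis
    proof (cases rule: cases_above)
      case (left m' q i)
      with d p k x show ?thesis by (auto simp: succ_def next_simps slice_of_def intro!: v)
    next
      case (right m' q i j)
      with d p k x show ?thesis by (auto simp: succ_def next_simps slice_of_def intro!: v)
    next
      case (inside m' q i)
      then have "outs q = 2" by (cases q) auto
      with inside assms(2) d x k show ?thesis by (auto simp: place_def slice_of_def)
    qed
  qed
qed

lemma vertical_starts:
  assumes "(x, y) \<in> verticals D" "fst x = k"
  shows "if down x then x \<in> starts k \<and> place x = None \<and> succ x = y
         else y \<in> starts k \<and> place y = None \<and> succ y = x"
  using assms vertical_points[OF assms(1)] vertical_succ[OF assms(1)] down_vertical[OF assms(1)]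
  by (elim verticalE) (auto simp: starts_def slice_of_def place_def)

definition constant_beside :: "nat \<Rightarrow> (point \<Rightarrow> 'b) \<Rightarrow> bool" where
  "constant_beside k l \<longleftrightarrow> (\<forall>x y. (x, y) \<in> verticals D \<longrightarrow> fst x = k \<longrightarrow> l x = l y)"

text \<open>
  The constraint that labellings are constant on vertical strands, slice by slice and in terms of
  \<open>succ\<close>: in a product of matrix entries along the strands it is the effect of identity matrices on the
  vertical parts.
\<close>

lemma constant_beside_iff:
  "constant_beside k l \<longleftrightarrow> (\<forall>x\<in>starts k - piece_starts k. l x = l (succ x))" (is "?R \<longleftrightarrow> ?L")
  unfolding constant_beside_def
proof (intro iffI)
  assume R: "\<forall>x y. (x, y) \<in> verticals D \<longrightarrow> fst x = k \<longrightarrow> l x = l y"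
  show ?L
  proof
    fix x assume x: "x \<in> starts k - piece_starts k"
    hence "x \<in> starts k" "place x = None" unfolding piece_starts_def by blast+
    from starts_vertical[OF this] R show "l x = l (succ x)"
      by (cases "down x") metis+
  qed
next
  assume L: ?L
  show "\<forall>x y. (x, y) \<in> verticals D \<longrightarrow> fst x = k \<longrightarrow> l x = l y"
  proof (intro allI impI)
    fix x y assume v: "(x, y) \<in> verticals D" "fst x = k"
    from vertical_starts[OF v] L show "l x = l y"
      by (auto simp: piece_starts_def split: if_splits)
  qed
qed

text \<open>
  On a finite set the orbit of a permutation is also closed under its inverse, hence under undirected
  steps; so it exhausts everything that is connected to its starting point.
\<close>

lemma orbit_eq_points:
  assumes x0: "x0 \<in> points D"
    and conn: "\<And>y. y \<in> points D \<Longrightarrow> (x0, y) \<in> (strand_steps D \<union> (strand_steps D)\<inverse>)\<^sup>*"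
  shows "orbit succ x0 = points D" "x0 \<in> orbit succ x0"
proof -
  have inj: "inj_on succ (points D)" by (rule inj_on_inverseI) (rule pred_succ)
  hence "succ ` points D = points D"
    using succ_in_points finite_points by (intro endo_inj_surj) auto
  with inj have "succ permutes points D"
    by (intro bij_imp_permutes) (auto simp: bij_betw_def succ_def)
  hence perm: "permutation succ" using finite_points by (auto simp: permutation_permutes)
  show self: "x0 \<in> orbit succ x0" by (rule permutation_self_in_orbit[OF perm])
  have "z \<in> orbit succ x0 \<Longrightarrow> z \<in> points D" for z
    by (induction rule: orbit.induct) (use x0 succ_in_points in auto)
  moreover have "y \<in> orbit succ x0" if "(x0, y) \<in> (strand_steps D \<union> (strand_steps D)\<inverse>)\<^sup>*" for y
    using that
  proof (induction rule: rtrancl_induct)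
    case base
    show ?case by (rule self)
  next
    case (step y z)
    then have "z = succ y \<or> y = succ z" using steps_succ by blast
    thus ?case
    proof
      assume "z = succ y" thus ?thesis using step.IH by (simp add: orbit.step)
    next
      assume y: "y = succ z"
      have "z \<in> orbit succ y"
        using permutation_self_in_orbit[OF perm, of z] by (rule orbit_swap) (simp add: y orbit.base)
      thus ?thesis using step.IH by (rule orbit_trans)
    qed
  qed
  ultimately show "orbit succ x0 = points D" using conn by blast
qed

lemma succ_cup:
  assumes "k < length D" "D ! k = (Cup, i)"
  shows "down (k, i) \<Longrightarrow> succ (k, i) = (k, Suc i)"
    "\<not> down (k, i) \<Longrightarrow> succ (k, Suc i) = (k, i)"
  using assms slice_points[OF assms] down_cup[OF assms] by (simp_all add: succ_def next_simps)

lemma succ_cap: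
  assumes "k < length D" "D ! k = (Cap, i)"
  shows "\<not> down (Suc k, i) \<Longrightarrow> succ (Suc k, i) = (Suc k, Suc i)"
    "down (Suc k, i) \<Longrightarrow> succ (Suc k, Suc i) = (Suc k, i)"
  using assms slice_points[OF assms] down_cap[OF assms] by (simp_all add: succ_def next_simps)

lemma succ_crossing:
  assumes "k < length D" "D ! k = (p, i)" "p = Over \<or> p = Under"
  shows "down (k, i) \<Longrightarrow> succ (k, i) = (Suc k, Suc i)"
    "down (k, Suc i) \<Longrightarrow> succ (k, Suc i) = (Suc k, i)"
    "\<not> down (k, i) \<Longrightarrow> succ (Suc k, Suc i) = (k, i)"
    "\<not> down (k, Suc i) \<Longrightarrow> succ (Suc k, i) = (k, Suc i)"
proof -
  have "ins p = 2" "outs p = 2" using assms(3) by auto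
  note slice_points(1,2)[OF assms(1,2) this(1)] slice_points(3,4)[OF assms(1,2) this(2)]
  with assms down_crossing[OF assms]
  show "down (k, i) \<Longrightarrow> succ (k, i) = (Suc k, Suc i)"
    "down (k, Suc i) \<Longrightarrow> succ (k, Suc i) = (Suc k, i)"
    "\<not> down (k, i) \<Longrightarrow> succ (Suc k, Suc i) = (k, i)"
    "\<not> down (k, Suc i) \<Longrightarrow> succ (Suc k, i) = (k, Suc i)"
    by (simp_all add: succ_def next_simps)
qed

text \<open>
  The direction along a strand is reversed exactly at minima and maxima.
\<close>

lemma down_succ:
  assumes x: "x \<in> points D"
  shows "case place x of
      Some (Cup, _) \<Rightarrow> down x \<and> \<not> down (succ x)
    | Some (Cap, _) \<Rightarrow> \<not> down x \<and> down (succ x)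
    | _ \<Rightarrow> down (succ x) = down x"
proof -
  define k where "k = slice_of x"
  have s: "x \<in> starts k" and k: "k < length D"
    using x slice_of_less[OF x] by (simp_all add: starts_def k_def)
  show ?thesis
  proof (cases "place x")
    case None
    have "down (succ x) = down x"
      using starts_vertical[OF s None] down_vertical by (cases "down x") metis+
    with None show ?thesis by simp
  next
    case (Some q)
    hence ps: "x \<in> piece_starts k" using s by (simp add: piece_starts_def)
    obtain p i where D: "D ! k = (p, i)" by force
    consider "p = Cup" | "p = Cap" | "p = Over \<or> p = Under" by (cases p) auto
    thus ?thesis
    proof cases
      case 1
      note D' = D[unfolded 1]
      have "x = (if down (k, i) then (k, i) else (k, Suc i))" using ps piece_starts_cup[OF k D'] by simp
      thus ?thesis using place_cup[OF k D'] succ_cup[OF k D'] down_cup[OF k D']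
        by (cases "down (k, i)") simp_all
    next
      case 2
      note D' = D[unfolded 2]
      have "x = (if down (Suc k, i) then (Suc k, Suc i) else (Suc k, i))" using ps piece_starts_cap[OF k D'] by simp
      thus ?thesis using place_cap[OF k D'] succ_cap[OF k D'] down_cap[OF k D']
        by (cases "down (Suc k, i)") simp_all
    next
      case 3
      have "x = (if down (k, i) then (k, i) else (Suc k, Suc i)) \<or>
            x = (if down (k, Suc i) then (k, Suc i) else (Suc k, i))"
        using ps piece_starts_crossing[OF k D 3] by simp
      thus ?thesis
      proof
        assume "x = (if down (k, i) then (k, i) else (Suc k, Suc i))"
        with 3 show ?thesis using place_crossing[OF k D 3] succ_crossing[OF k D 3] down_crossing[OF k D 3]
          by (cases "down (k, i)"; elim disjE) simp_all
      next
        assume "x = (if down (k, Suc i) then (k, Suc i) else (Suc k, i))"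
        with 3 show ?thesis using place_crossing[OF k D 3] succ_crossing[OF k D 3] down_crossing[OF k D 3]
          by (cases "down (k, Suc i)"; elim disjE) simp_all
      qed
    qed
  qed
qed

lemma prod_starts:
  assumes "\<And>x. place x = None \<Longrightarrow> h x = 1"
  shows "prod h (starts k) = prod h (piece_starts k)"
  using finite_starts assms unfolding piece_starts_def
  by (intro prod.mono_neutral_right) blast+

lemma sum_starts:
  assumes "\<And>x. place x = None \<Longrightarrow> h x = 0"
  shows "sum h (starts k) = sum h (piece_starts k)"
  using finite_starts assms unfolding piece_starts_def
  by (intro sum.mono_neutral_right) blast+

lemma strands_count:
  assumes "k \<le> length D"
  shows "real (strands D k) = 2 * (\<Sum>j<k. of_bool (fst (D ! j) = Cap) - of_bool (fst (D ! j) = Cup))"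
  using assms
proof (induction k)
  case (Suc k)
  obtain p i where D: "D ! k = (p, i)" by force
  have k: "k < length D" using Suc.prems by simp
  show ?case using Suc strands_Suc[OF k D] slice_fits[OF k D] by (cases p) (auto simp: D)
qed simp

text \<open>
  The number of strands is 0 above and below the diagram. Therefore the half turns at minima and
  maxima can be counted as full turns at the clockwise minima and the counterclockwise maxima only.
\<close>

lemma cups_eq_caps:
  "(\<Sum>j<length D. of_bool (fst (D ! j) = Cap) - of_bool (fst (D ! j) = Cup)) = (0::real)"
  using strands_count[of "length D"] by simp

end

section \<open>Connected diagrams and colourings\<close>

definition connected_diagram :: "diagram \<Rightarrow> bool" where
  "connected_diagram D \<longleftrightarrow> (\<exists>x\<in>points D. \<forall>y\<in>points D. (x, y) \<in> (strand_steps D \<union> (strand_steps D)\<inverse>)\<^sup>*)"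

lemma knot_diagram_connected:
  assumes "knot_diagram D"
  shows "connected_diagram D"
proof -
  obtain X where X: "points D // same_component D = {X}"
    using assms by (auto simp: knot_diagram_def components_def card_1_singleton_iff)
  have cls: "same_component D `` {y} = X" if "y \<in> points D" for y
    using quotientI[OF that, of "same_component D"] X by simp
  have "points D \<noteq> {}" using X by auto
  then obtain x where x: "x \<in> points D" by auto
  have "(x, y) \<in> same_component D" if y: "y \<in> points D" for y
  proof -
    have "y \<in> same_component D `` {y}" using y by (simp add: same_component_def)
    thus ?thesis unfolding cls[OF y] cls[OF x, symmetric] by simp
  qed
  with x show ?thesis unfolding connected_diagram_def same_component_def by blast
qed

text \<open>
  Colourings of the positions of a level are total functions, the colour beyond the last strand being
  \<open>False\<close>. The effect of a piece is then defined without reference to the number of strands, and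
  the operators attached to the two sides of a move agree everywhere.
\<close>

definition insert_pair :: "nat \<Rightarrow> bool \<Rightarrow> (nat \<Rightarrow> bool) \<Rightarrow> nat \<Rightarrow> bool" where
  "insert_pair i b u = (\<lambda>j. if j < i then u j else if j < i + 2 then b else u (j - 2))"

definition delete_pair :: "nat \<Rightarrow> (nat \<Rightarrow> bool) \<Rightarrow> nat \<Rightarrow> bool" where
  "delete_pair i u = (\<lambda>j. if j < i then u j else u (j + 2))"

definition swap_pair :: "nat \<Rightarrow> (nat \<Rightarrow> bool) \<Rightarrow> nat \<Rightarrow> bool" where
  "swap_pair i u = (\<lambda>j. if j = i then u (Suc i) else if j = Suc i then u i else u j)"

fun next_colours :: "slice \<Rightarrow> (nat \<Rightarrow> bool) \<Rightarrow> (nat \<Rightarrow> bool) set" where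
  "next_colours (Cup, i) u = (if u i = u (Suc i) then {delete_pair i u} else {})"
| "next_colours (Cap, i) u = {insert_pair i True u, insert_pair i False u}"
| "next_colours (Over, i) u = {swap_pair i u}"
| "next_colours (Under, i) u = {swap_pair i u}"

text \<open>
  The transfer operator of a slice: \<open>f\<close> weighs the colourings of the level below, and the result weighs
  those of the level above. Stacking slices composes the operators, so invariance under a move need
  only be checked on the slices that are changed.
\<close>

definition slice_count :: "slice \<Rightarrow> ((nat \<Rightarrow> bool) \<Rightarrow> nat) \<Rightarrow> (nat \<Rightarrow> bool) \<Rightarrow> nat" where
  "slice_count s f u = sum f (next_colours s u)"

abbreviation colour_count :: "diagram \<Rightarrow> ((nat \<Rightarrow> bool) \<Rightarrow> nat) \<Rightarrow> (nat \<Rightarrow> bool) \<Rightarrow> nat" where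
  "colour_count \<equiv> foldr slice_count"

lemma slice_count_simps:
  "slice_count (Cup, i) f u = (if u i = u (Suc i) then f (delete_pair i u) else 0)"
  "slice_count (Cap, i) f u = f (insert_pair i True u) + f (insert_pair i False u)"
  "slice_count (Over, i) f u = f (swap_pair i u)"
  "slice_count (Under, i) f u = f (swap_pair i u)"
proof -
  have "insert_pair i True u i \<noteq> insert_pair i False u i" by (simp add: insert_pair_def)
  hence "insert_pair i True u \<noteq> insert_pair i False u" by metis
  thus "slice_count (Cap, i) f u = f (insert_pair i True u) + f (insert_pair i False u)"
    by (simp add: slice_count_def)
qed (simp_all add: slice_count_def)

lemma Suc_Suc_diff_2: "2 \<le> n \<Longrightarrow> Suc (Suc (n - 2)) = n"
  by simp

lemmas pair_defs = insert_pair_def delete_pair_def swap_pair_def fun_eq_iff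

lemma exchange_pairs:
  assumes "i \<le> j"
  shows "delete_pair j (delete_pair i u) = delete_pair i (delete_pair (Suc (Suc j)) u)"
    "insert_pair j b (delete_pair i u) = delete_pair i (insert_pair (Suc (Suc j)) b u)"
    "swap_pair j (delete_pair i u) = delete_pair i (swap_pair (Suc (Suc j)) u)"
    "delete_pair (Suc (Suc j)) (insert_pair i b u) = insert_pair i b (delete_pair j u)"
    "insert_pair (Suc (Suc j)) c (insert_pair i b u) = insert_pair i b (insert_pair j c u)"
    "swap_pair (Suc (Suc j)) (insert_pair i b u) = insert_pair i b (swap_pair j u)"
    "delete_pair (Suc (Suc j)) (swap_pair i u) = swap_pair i (delete_pair (Suc (Suc j)) u)"
    "insert_pair (Suc (Suc j)) b (swap_pair i u) = swap_pair i (insert_pair (Suc (Suc j)) b u)"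
    "swap_pair (Suc (Suc j)) (swap_pair i u) = swap_pair i (swap_pair (Suc (Suc j)) u)"
proof -
  show "delete_pair j (delete_pair i u) = delete_pair i (delete_pair (Suc (Suc j)) u)"
    using assms by (auto simp: pair_defs Suc_Suc_diff_2)
  show "insert_pair j b (delete_pair i u) = delete_pair i (insert_pair (Suc (Suc j)) b u)"
    using assms by (auto simp: pair_defs Suc_diff_le Suc_Suc_diff_2)
  show "swap_pair j (delete_pair i u) = delete_pair i (swap_pair (Suc (Suc j)) u)"
    using assms by (auto simp: pair_defs)
  show "delete_pair (Suc (Suc j)) (insert_pair i b u) = insert_pair i b (delete_pair j u)"
    using assms by (auto simp: pair_defs Suc_diff_le Suc_Suc_diff_2)
  show "insert_pair (Suc (Suc j)) c (insert_pair i b u) = insert_pair i b (insert_pair j c u)"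
    using assms by (auto simp: pair_defs)
  show "swap_pair (Suc (Suc j)) (insert_pair i b u) = insert_pair i b (swap_pair j u)"
    using assms by (auto simp: pair_defs Suc_diff_le Suc_Suc_diff_2)
  show "delete_pair (Suc (Suc j)) (swap_pair i u) = swap_pair i (delete_pair (Suc (Suc j)) u)"
    using assms by (auto simp: pair_defs)
  show "insert_pair (Suc (Suc j)) b (swap_pair i u) = swap_pair i (insert_pair (Suc (Suc j)) b u)"
    using assms by (auto simp: pair_defs)
  show "swap_pair (Suc (Suc j)) (swap_pair i u) = swap_pair i (swap_pair (Suc (Suc j)) u)"
    using assms by (auto simp: pair_defs)
qed

lemma pair_lookup:
  assumes "i \<le> j"
  shows "delete_pair i u j = u (Suc (Suc j))" "insert_pair i b u (Suc (Suc j)) = u j"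
    "swap_pair i u (Suc (Suc j)) = u (Suc (Suc j))"
    "delete_pair (Suc (Suc j)) u i = u i" "delete_pair (Suc (Suc j)) u (Suc i) = u (Suc i)"
    "insert_pair (Suc (Suc j)) b u i = u i" "insert_pair (Suc (Suc j)) b u (Suc i) = u (Suc i)"
    "swap_pair (Suc (Suc j)) u i = u i" "swap_pair (Suc (Suc j)) u (Suc i) = u (Suc i)"
  using assms by (auto simp: delete_pair_def insert_pair_def swap_pair_def)

lemma insert_lookup:
  "insert_pair i b u i = b" "insert_pair i b u (Suc i) = b" "insert_pair i b u (Suc (Suc i)) = u i"
  "insert_pair (Suc i) b u i = u i"
  by (simp_all add: insert_pair_def)

lemma swap_lookup:
  "swap_pair i u i = u (Suc i)" "swap_pair i u (Suc i) = u i" "swap_pair i u (Suc (Suc i)) = u (Suc (Suc i))"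
  "swap_pair (Suc i) u i = u i"
  by (simp_all add: swap_pair_def)

lemma planar_move_count: "planar_move x y \<Longrightarrow> colour_count x f = colour_count y f"
proof (induction rule: planar_move.induct)
  case (exchange i j p q)
  have j: "i \<le> Suc j" using exchange by simp
  show ?case
    by (rule ext; cases p; cases q)
       (simp_all add: slice_count_simps exchange_pairs[OF exchange] pair_lookup[OF exchange] pair_lookup[OF j])
next
  case (zigzag1 i)
  have "delete_pair (Suc i) (insert_pair i (u i) u) = u" for u by (auto simp: pair_defs less_Suc_eq)
  hence "u i \<Longrightarrow> delete_pair (Suc i) (insert_pair i True u) = u" "\<not> u i \<Longrightarrow> delete_pair (Suc i) (insert_pair i False u) = u"
    for u by (metis (full_types))+
  thus ?case by (intro ext) (auto simp: slice_count_simps insert_lookup)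
next
  case (zigzag2 i)
  have "delete_pair i (insert_pair (Suc i) (u i) u) = u" for u by (auto simp: pair_defs less_Suc_eq)
  hence "u i \<Longrightarrow> delete_pair i (insert_pair (Suc i) True u) = u" "\<not> u i \<Longrightarrow> delete_pair i (insert_pair (Suc i) False u) = u"
    for u by (metis (full_types))+
  thus ?case by (intro ext) (auto simp: slice_count_simps insert_lookup)
next
  case (cup_slide1 i)
  have "delete_pair i (swap_pair (Suc i) u) = delete_pair (Suc i) (swap_pair i u)" for u by (auto simp: pair_defs less_Suc_eq)
  thus ?case by (intro ext) (simp add: slice_count_simps swap_lookup)
next
  case (cup_slide2 i)
  have "delete_pair i (swap_pair (Suc i) u) = delete_pair (Suc i) (swap_pair i u)" for u by (auto simp: pair_defs less_Suc_eq)
  thus ?case by (intro ext) (simp add: slice_count_simps swap_lookup)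
next
  case (cap_slide1 i)
  have "swap_pair (Suc i) (insert_pair i b u) = swap_pair i (insert_pair (Suc i) b u)" for b u by (auto simp: pair_defs)
  thus ?case by (intro ext) (simp add: slice_count_simps)
next
  case (cap_slide2 i)
  have "swap_pair (Suc i) (insert_pair i b u) = swap_pair i (insert_pair (Suc i) b u)" for b u by (auto simp: pair_defs)
  thus ?case by (intro ext) (simp add: slice_count_simps)
qed

lemma reidemeister_move_count: "reidemeister_move x y \<Longrightarrow> colour_count x f = colour_count y f"
proof (induction rule: reidemeister_move.induct)
  case (I_cap p i)
  have "swap_pair i (insert_pair i b u) = insert_pair i b u" for b u by (auto simp: pair_defs)
  with I_cap show ?case by (auto simp: slice_count_simps)
next
  case (I_cup p i)
  have "delete_pair i (swap_pair i u) = delete_pair i u" for u by (auto simp: pair_defs)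
  with I_cup show ?case by (auto simp: slice_count_simps swap_pair_def)
next
  case (II1 i)
  have "swap_pair i (swap_pair i u) = u" for u by (auto simp: pair_defs)
  thus ?case by (auto simp: slice_count_simps)
next
  case (II2 i)
  have "swap_pair i (swap_pair i u) = u" for u by (auto simp: pair_defs)
  thus ?case by (auto simp: slice_count_simps)
next
  case (III i)
  have "swap_pair i (swap_pair (Suc i) (swap_pair i u)) = swap_pair (Suc i) (swap_pair i (swap_pair (Suc i) u))" for u
    by (auto simp: pair_defs)
  thus ?case by (auto simp: slice_count_simps)
qed

lemma ambient_isotopic_count: "ambient_isotopic D E \<Longrightarrow> colour_count D f = colour_count E f"
proof -
  have "colour_count D f = colour_count E f" if "local_change D E" for D E
    using that planar_move_count reidemeister_move_count unfolding local_change_def by auto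
  note change = this
  assume "ambient_isotopic D E"
  hence "equivclp local_change D E" by (simp add: ambient_isotopic_def)
  thus ?thesis by (induction rule: equivclp_induct) (auto dest: change)
qed

lemma position_cases:
  fixes v i :: nat
  obtains "v < i" | "v = i" | "v = Suc i" | j where "v = j + 2" "i \<le> j"
proof -
  consider "v < i" | "v = i" | "v = Suc i" | "i + 2 \<le> v" by linarith
  thus thesis by cases (use that(4)[of "v - 2"] that(1-3) in auto)
qed

context oriented_diagram
begin

definition points_upto :: "nat \<Rightarrow> point set" where
  "points_upto k = {(m, u). m \<le> k \<and> u < strands D m}"

definition colourings :: "nat \<Rightarrow> (point \<Rightarrow> bool) set" where
  "colourings k = {l \<in> points_upto k \<rightarrow>\<^sub>E UNIV.
     \<forall>x\<in>points_upto k. \<forall>y\<in>points_upto k. (x, y) \<in> strand_steps D \<longrightarrow> l x = l y}"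

definition level_colours :: "(point \<Rightarrow> bool) \<Rightarrow> nat \<Rightarrow> nat \<Rightarrow> bool" where
  "level_colours l k = (\<lambda>u. u < strands D k \<and> l (k, u))"

lemma finite_colourings: "finite (colourings k)"
proof -
  have "finite (points_upto k)"
    by (rule finite_subset[of _ "Sigma {..k} (\<lambda>m. {..<strands D m})"]) (auto simp: points_upto_def)
  hence "finite (points_upto k \<rightarrow>\<^sub>E (UNIV :: bool set))" by (intro finite_PiE) auto
  thus ?thesis by (rule rev_finite_subset) (auto simp: colourings_def)
qed

lemma finite_next_colours: "finite (next_colours s u)"
  by (cases "(s, u)" rule: next_colours.cases) auto

lemma level_colours_next:
  assumes k: "k < length D" and l: "l \<in> colourings (Suc k)"
  shows "level_colours l (Suc k) \<in> next_colours (D ! k) (level_colours l k)"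
proof -
  obtain p i where D: "D ! k = (p, i)" by force
  let ?u = "level_colours l k" and ?w = "level_colours l (Suc k)"
  note f = slice_fits[OF k D] strands_Suc[OF k D]
  have step: "l x = l y" if "(x, y) \<in> strand_steps D" "fst x \<le> Suc k" "fst y \<le> Suc k" for x y
    using that l steps_points[OF that(1)] by (auto simp: colourings_def points_upto_def points_def)
  have left: "?w v = ?u v" if "v < i" for v
  proof -
    have "((k, v), (Suc k, v)) \<in> verticals D" using k D that f by (simp add: vertical_iff)
    hence "l (k, v) = l (Suc k, v)" by (intro step) (auto simp: strand_steps_def)
    moreover have "v < strands D k" "v < strands D (Suc k)" using that f by linarith+
    ultimately show ?thesis by (simp add: level_colours_def)
  qed
  have right: "?w (j + outs p) = ?u (j + ins p)" if "i \<le> j" for j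
  proof (cases "j + ins p < strands D k")
    case True
    have "((k, j + ins p), (Suc k, j + outs p)) \<in> verticals D" using k D that True by (simp add: vertical_iff)
    hence "l (k, j + ins p) = l (Suc k, j + outs p)" by (intro step) (auto simp: strand_steps_def)
    moreover have "j + outs p < strands D (Suc k)" using True f by linarith
    ultimately show ?thesis using True by (simp add: level_colours_def)
  next
    case False
    moreover have "\<not> j + outs p < strands D (Suc k)" using False f by linarith
    ultimately show ?thesis by (simp add: level_colours_def)
  qed
  have crossing: "?w = swap_pair i ?u" if p: "p = Over \<or> p = Under"
  proof -
    have s: "((k, i), (Suc k, Suc i)) \<in> strand_steps D" "((k, Suc i), (Suc k, i)) \<in> strand_steps D"
      using k D p unfolding strand_steps_def by auto
    have "l (k, i) = l (Suc k, Suc i)" "l (k, Suc i) = l (Suc k, i)"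
      using step[OF s(1)] step[OF s(2)] by simp_all
    moreover have two: "ins p = 2" "outs p = 2" using p by auto
    ultimately have eq: "?w (Suc i) = ?u i" "?w i = ?u (Suc i)" using f by (auto simp: level_colours_def)
    have "?w v = swap_pair i ?u v" for v
      by (rule position_cases[of v i]) (use left right eq two in \<open>auto simp: swap_pair_def\<close>)
    thus ?thesis by blast
  qed
  show ?thesis
  proof (cases p)
    case Cup
    have "l (k, i) = l (k, Suc i)" using k D Cup by (intro step) (auto simp: strand_steps_def)
    moreover have "?w = delete_pair i ?u"
      using left right Cup by (auto simp: delete_pair_def fun_eq_iff)
    ultimately show ?thesis using Cup D f by (simp add: level_colours_def)
  next
    case Cap
    have "l (Suc k, i) = l (Suc k, Suc i)" using k D Cap by (intro step) (auto simp: strand_steps_def)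
    hence eq: "?w (Suc i) = ?w i" using Cap f by (simp add: level_colours_def)
    have "?w v = insert_pair i (?w i) ?u v" for v
      by (rule position_cases[of v i]) (use left right eq Cap in \<open>auto simp: insert_pair_def\<close>)
    hence "?w = insert_pair i (?w i) ?u" by blast
    thus ?thesis using Cap D by (cases "?w i") auto
  next
    case Over
    thus ?thesis using crossing D by simp
  next
    case Under
    thus ?thesis using crossing D by simp
  qed
qed

text \<open>
  A colouring of one more slice is determined by its restriction and by the new bottom level, and the
  latter is one of the continuations counted by the transfer operator.
\<close>

lemma colourings_step:
  assumes k: "k < length D"
  shows "(\<Sum>l\<in>colourings (Suc k). f (level_colours l (Suc k)))
    \<le> (\<Sum>l\<in>colourings k. slice_count (D ! k) f (level_colours l k))"
proof -
  define \<phi> where "\<phi> l = (restrict l (points_upto k), level_colours l (Suc k))" for l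
  let ?S = "Sigma (colourings k) (\<lambda>l. next_colours (D ! k) (level_colours l k))"
  have sub: "points_upto k \<subseteq> points_upto (Suc k)" by (auto simp: points_upto_def)
  have inj: "inj_on \<phi> (colourings (Suc k))"
  proof
    fix l l' assume l: "l \<in> colourings (Suc k)" "l' \<in> colourings (Suc k)" and eq: "\<phi> l = \<phi> l'"
    show "l = l'"
    proof
      fix x :: point
      obtain m u where x: "x = (m, u)" by force
      consider "x \<in> points_upto k" | "m = Suc k" "u < strands D (Suc k)" | "x \<notin> points_upto (Suc k)"
        using x by (auto simp: points_upto_def le_Suc_eq)
      thus "l x = l' x"
      proof cases
        case 1
        have "restrict l (points_upto k) x = restrict l' (points_upto k) x" using eq by (simp add: \<phi>_def)
        thus ?thesis using 1 by simp
      next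
        case 2
        have "level_colours l (Suc k) u = level_colours l' (Suc k) u" using eq by (simp add: \<phi>_def)
        thus ?thesis using 2 x by (simp add: level_colours_def)
      next
        case 3
        hence "l x = undefined" "l' x = undefined" using l by (auto simp: colourings_def intro: PiE_arb)
        thus ?thesis by simp
      qed
    qed
  qed
  have level: "level_colours (restrict l (points_upto k)) k = level_colours l k" for l
    by (auto simp: level_colours_def points_upto_def)
  have img: "\<phi> ` colourings (Suc k) \<subseteq> ?S"
  proof
    fix z assume "z \<in> \<phi> ` colourings (Suc k)"
    then obtain l where l: "l \<in> colourings (Suc k)" and z: "z = \<phi> l" by auto
    have "l x = l y" if "x \<in> points_upto k" "y \<in> points_upto k" "(x, y) \<in> strand_steps D" for x y
      using l sub that unfolding colourings_def by blast
    hence "restrict l (points_upto k) \<in> colourings k" by (auto simp: colourings_def)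
    thus "z \<in> ?S" using level_colours_next[OF k l] by (simp add: z \<phi>_def level)
  qed
  have "(\<Sum>l\<in>colourings (Suc k). f (level_colours l (Suc k))) = (\<Sum>z\<in>\<phi> ` colourings (Suc k). f (snd z))"
    by (subst sum.reindex[OF inj]) (simp add: \<phi>_def)
  also have "\<dots> \<le> (\<Sum>z\<in>?S. f (snd z))"
    by (rule sum_mono2[OF _ img]) (auto intro!: finite_SigmaI finite_colourings finite_next_colours)
  also have "\<dots> = (\<Sum>l\<in>colourings k. slice_count (D ! k) f (level_colours l k))"
    by (simp add: slice_count_def sum.Sigma finite_colourings finite_next_colours split_def)
  finally show ?thesis .
qed

lemma colourings_le:
  assumes "k \<le> length D"
  shows "(\<Sum>l\<in>colourings k. f (level_colours l k)) \<le> colour_count (take k D) f (\<lambda>_. False)"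
  using assms
proof (induction k arbitrary: f)
  case 0
  have empty: "points_upto 0 = {}" by (auto simp: points_upto_def)
  have "colourings 0 = {\<lambda>_. undefined}" by (auto simp: colourings_def empty)
  thus ?case by (simp add: level_colours_def)
next
  case (Suc k)
  then have k: "k < length D" by simp
  have "(\<Sum>l\<in>colourings (Suc k). f (level_colours l (Suc k)))
      \<le> (\<Sum>l\<in>colourings k. slice_count (D ! k) f (level_colours l k))"
    by (rule colourings_step[OF k])
  also have "\<dots> \<le> colour_count (take k D) (slice_count (D ! k) f) (\<lambda>_. False)"
    using Suc by simp
  finally show ?case by (simp add: take_Suc_conv_app_nth[OF k])
qed

text \<open>
  In a disconnected diagram the two constant colourings and the one that distinguishes a single
  component from the rest are three different ones.
\<close>

lemma connected_if_two_colourings: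
  assumes two: "colour_count D (\<lambda>_. 1) (\<lambda>_. False) = 2"
  shows "connected_diagram D"
proof (rule ccontr)
  assume "\<not> connected_diagram D"
  define reach where "reach x y \<longleftrightarrow> (x, y) \<in> (strand_steps D \<union> (strand_steps D)\<inverse>)\<^sup>*" for x y
  have pts: "points_upto (length D) = points D" by (simp add: points_upto_def points_def)
  have D: "0 < length D" using two by (cases D) auto
  obtain p i where D0: "D ! 0 = (p, i)" by force
  \<comment> \<open>No strand enters from above, so the first piece is a maximum, and the diagram has a point.\<close>
  have "p = Cap" using slice_fits[OF D D0] by (cases p) auto
  hence x: "(1, 0) \<in> points D" (is "?x \<in> _") using strands_Suc[OF D D0] D by (simp add: points_def Suc_le_eq)
  then obtain y where y: "y \<in> points D" and ny: "\<not> reach ?x y"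
    using \<open>\<not> connected_diagram D\<close> unfolding connected_diagram_def reach_def by blast
  have step: "reach ?x a \<longleftrightarrow> reach ?x b" if "(a, b) \<in> strand_steps D" for a b
    using that unfolding reach_def by (meson UnI1 UnI2 converseI rtrancl.rtrancl_into_rtrancl)
  define c where "c h = restrict h (points D)" for h :: "point \<Rightarrow> bool"
  let ?C = "{c (\<lambda>_. True), c (\<lambda>_. False), c (reach ?x)}"
  have "?C \<subseteq> colourings (length D)" using step by (auto simp: colourings_def pts c_def)
  hence "card ?C \<le> card (colourings (length D))" by (rule card_mono[OF finite_colourings])
  also have "\<dots> \<le> 2" using colourings_le[of "length D" "\<lambda>_. 1"] two by simp
  also have "card ?C = 3"
  proof -
    have "reach ?x ?x" by (simp add: reach_def)
    hence "c (\<lambda>_. True) y \<noteq> c (reach ?x) y" "c (\<lambda>_. False) ?x \<noteq> c (reach ?x) ?x"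
      "c (\<lambda>_. True) y \<noteq> c (\<lambda>_. False) y"
      using x y ny by (simp_all add: c_def)
    hence "c (\<lambda>_. True) \<noteq> c (reach ?x)" "c (\<lambda>_. False) \<noteq> c (reach ?x)" "c (\<lambda>_. True) \<noteq> c (\<lambda>_. False)"
      by metis+
    thus ?thesis by simp
  qed
  finally show False by simp
qed

lemma unknot_connected:
  assumes "unknot_diagram D"
  shows "connected_diagram D"
proof (rule connected_if_two_colourings)
  have "colour_count D (\<lambda>_. 1) (\<lambda>_. False) = colour_count [(Cap, 0), (Cup, 0)] (\<lambda>_. 1) (\<lambda>_. False)"
    using assms ambient_isotopic_count unfolding unknot_diagram_def by metis
  also have "\<dots> = 2" by (simp add: slice_count_simps insert_pair_def)
  finally show "colour_count D (\<lambda>_. 1) (\<lambda>_. False) = 2" .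
qed

end

section \<open>Matrices\<close>

lemma mat_mult_entry: "(mat c ** A) $ i $ j = c * A $ i $ j"
  for A :: "'a::comm_semiring_1 ^ 'n ^ 'm"
  by (simp add: matrix_matrix_mult_def mat_def if_distrib[of "\<lambda>x. x * _"] cong: if_cong)

lemma mat_commute: "A ** mat c = mat c ** A"
  for A :: "'a::comm_semiring_1 ^ 'n ^ 'm"
  by (simp add: vec_eq_iff mat_mult_entry)
     (simp add: matrix_matrix_mult_def mat_def if_distrib[of "\<lambda>x. _ * x"] mult.commute cong: if_cong)

lemma mat_left_commute: "A ** (mat c ** B) = mat c ** (A ** B)"
  for A :: "'a::comm_semiring_1 ^ 'n ^ 'm" and B :: "'a ^ 'k ^ 'n"
  by (simp add: matrix_mul_assoc mat_commute)

lemma mat_mat: "mat c ** mat d = (mat (c * d) :: 'a::comm_semiring_1 ^ 'n ^ 'n)"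
  by (simp add: vec_eq_iff mat_mult_entry) (simp add: mat_def)

lemma mat_mat_left: "mat c ** (mat d ** A) = mat (c * d) ** A"
  for A :: "'a::comm_semiring_1 ^ 'n ^ 'm"
  by (simp add: matrix_mul_assoc mat_mat)

lemma transpose_mat: "transpose (mat c) = (mat c :: 'a::zero ^ 'n ^ 'n)"
  by (simp add: vec_eq_iff transpose_def mat_def eq_commute)

lemma mat_1_nonzero: "(mat 1 :: 'a::zero_neq_one ^ 'n ^ 'n) \<noteq> 0"
  by (auto simp: vec_eq_iff mat_def)

lemma mat_inject: "(mat c :: 'a::zero ^ 'n ^ 'n) = mat d \<longleftrightarrow> c = d"
  by (auto simp: vec_eq_iff mat_def)

text \<open>
  The power operator for this type acts entrywise, hence a separate matrix power.
\<close>

primrec mpow :: "'a::semiring_1 ^ 'n ^ 'n \<Rightarrow> nat \<Rightarrow> 'a ^ 'n ^ 'n" where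
  "mpow A 0 = mat 1"
| "mpow A (Suc n) = A ** mpow A n"

lemma mpow_add: "mpow A (m + n) = mpow A m ** mpow A n"
  by (induction m) (simp_all add: matrix_mul_assoc[symmetric])

lemma mpow_commute1: "A ** B = B ** A \<Longrightarrow> A ** mpow B n = mpow B n ** A"
  by (induction n) (simp_all, metis matrix_mul_assoc)

lemma mpow_commute: "A ** B = B ** A \<Longrightarrow> mpow A m ** mpow B n = mpow B n ** mpow A m"
  by (intro mpow_commute1 mpow_commute1[symmetric]) simp

lemma mpow_mult: "A ** B = B ** A \<Longrightarrow> mpow (A ** B) n = mpow A n ** mpow B n"
proof (induction n)
  case (Suc n)
  then show ?case using mpow_commute1[of B A n] by simp (metis matrix_mul_assoc)
qed simp

lemma mpow_mat: "mpow (mat c) n = (mat (c ^ n) :: 'a::comm_semiring_1 ^ 'n ^ 'n)"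
  by (induction n) (simp_all add: mat_mat)

lemma mpow_inverse: "A ** B = mat 1 \<Longrightarrow> mpow A n ** mpow B n = mat 1"
proof (induction n)
  case (Suc n)
  have "mpow A (Suc n) ** mpow B (Suc n) = (mpow A n ** A) ** (B ** mpow B n)"
    using mpow_commute1[of A A n] by simp
  also have "\<dots> = mpow A n ** (A ** B) ** mpow B n" by (simp add: matrix_mul_assoc)
  finally show ?case using Suc by simp
qed simp

lemma mpow_cancel:
  assumes "A ** B = mat 1"
  shows "mpow A (m + d) ** mpow B (n + d) = mpow A m ** mpow B n"
proof -
  have "mpow A (m + d) ** mpow B (n + d) = mpow A m ** (mpow A d ** mpow B d) ** mpow B n"
    by (simp add: mpow_add matrix_mul_assoc[symmetric] add.commute[of n])
  thus ?thesis by (simp add: mpow_inverse[OF assms])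
qed

text \<open>
  Powers of mutually inverse matrices: only the difference of the exponents matters. This is what
  reduces the numbers of positive and negative crossings to the writhe, and the numbers of turns in
  either direction to the Whitney degree.
\<close>

lemma mpow_balance:
  assumes "A ** B = mat 1" and "m + n' = m' + n"
  shows "mpow A m ** mpow B n = mpow A m' ** mpow B n'"
proof (cases "m \<le> m'")
  case True
  then obtain d where "m' = m + d" "n' = n + d" using assms(2) le_Suc_ex by fastforce
  then show ?thesis by (simp add: mpow_cancel[OF assms(1)])
next
  case False
  then obtain d where "m = m' + d" "n = n' + d" using assms(2) le_Suc_ex[of m' m] by fastforce
  then show ?thesis by (simp add: mpow_cancel[OF assms(1)])
qed

section \<open>State models of swap form\<close>

lemma swap_form_entry: "(tensor_op F G ** swap_op) $ (c, d) $ (a, b) = F $ c $ b * G $ d $ a"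
proof -
  have "(tensor_op F G ** swap_op) $ (c, d) $ (a, b)
      = (\<Sum>x\<in>UNIV. (if x = (b, a) then F $ c $ fst x * G $ d $ snd x else 0))"
    unfolding matrix_matrix_mult_def tensor_op_def swap_op_def
    by (simp add: if_distrib[of "\<lambda>x. _ * x"] cong: if_cong)
  thus ?thesis by simp
qed

lemma sum_triple: "(\<Sum>x\<in>UNIV. h x) = (\<Sum>a\<in>UNIV. \<Sum>b\<in>UNIV. \<Sum>c\<in>UNIV. h (a, b, c))"
  for h :: "'a::finite \<times> 'b::finite \<times> 'c::finite \<Rightarrow> 'd::comm_monoid_add"
  by (simp add: sum.cartesian_product)

lemma sum_pair: "(\<Sum>x\<in>UNIV. h x) = (\<Sum>a\<in>UNIV. \<Sum>b\<in>UNIV. h (a, b))"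
  for h :: "'a::finite \<times> 'b::finite \<Rightarrow> 'd::comm_monoid_add"
  by (simp add: sum.cartesian_product)

lemma sum_if_const: "(\<Sum>b\<in>S. if P then h b else 0) = (if P then sum h S else 0)"
  by simp

lemmas delta_simps = sum_if_const if_distrib[of "\<lambda>x. x * _"] if_distrib[of "\<lambda>x. _ * x"]

lemma op12_entry: "op12 (tensor_op F G ** swap_op) $ (c1, c2, c3) $ (a1, a2, a3)
    = (if c3 = a3 then F $ c1 $ a2 * G $ c2 $ a1 else 0)"
  by (simp add: op12_def swap_form_entry)

lemma op23_entry: "op23 (tensor_op F G ** swap_op) $ (c1, c2, c3) $ (a1, a2, a3)
    = (if c1 = a1 then F $ c2 $ a3 * G $ c3 $ a2 else 0)"
  by (simp add: op23_def swap_form_entry)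

text \<open>
  Both sides of the Yang-Baxter equation reverse the order of the three tensor factors and act on them
  by \<open>F\<^sup>2\<close> and \<open>G\<^sup>2\<close> on the outer ones; on the middle one they act by \<open>G F\<close> and
  \<open>F G\<close>, respectively.
\<close>

lemma yang_baxter_swap_form:
  fixes F G :: "complex ^ 'n::finite ^ 'n"
  assumes "yang_baxter (tensor_op F G ** swap_op)"
    and nz: "F ** F \<noteq> 0" "G ** G \<noteq> 0"
  shows "F ** G = G ** F"
proof -
  let ?R = "tensor_op F G ** swap_op"
  have 1: "(op12 ?R ** op23 ?R) $ (c1, c2, c3) $ (a1, a2, a3) = (F ** F) $ c1 $ a3 * G $ c2 $ a1 * G $ c3 $ a2" 
    for c1 c2 c3 a1 a2 a3
    by (simp add: matrix_matrix_mult_def[of "op12 ?R"] sum_triple op12_entry op23_entry delta_simps cong: if_cong)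
       (simp add: matrix_matrix_mult_def sum_distrib_right sum_distrib_left mult_ac)
  have 2: "(op23 ?R ** op12 ?R) $ (c1, c2, c3) $ (a1, a2, a3) = F $ c1 $ a2 * F $ c2 $ a3 * (G ** G) $ c3 $ a1" 
    for c1 c2 c3 a1 a2 a3
    by (simp add: matrix_matrix_mult_def[of "op23 ?R"] sum_triple op12_entry op23_entry delta_simps cong: if_cong)
       (simp add: matrix_matrix_mult_def sum_distrib_right sum_distrib_left mult_ac)
  have 3: "(op12 ?R ** op23 ?R ** op12 ?R) $ (c1, c2, c3) $ (a1, a2, a3)
      = (F ** F) $ c1 $ a3 * (G ** F) $ c2 $ a2 * (G ** G) $ c3 $ a1" for c1 c2 c3 a1 a2 a3
    by (simp add: matrix_matrix_mult_def[of "op12 ?R ** op23 ?R"] sum_triple 1 op12_entry delta_simps cong: if_cong)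
       (simp add: matrix_matrix_mult_def[of G] sum_distrib_right sum_distrib_left mult_ac)
  have 4: "(op23 ?R ** op12 ?R ** op23 ?R) $ (c1, c2, c3) $ (a1, a2, a3)
      = (F ** F) $ c1 $ a3 * (F ** G) $ c2 $ a2 * (G ** G) $ c3 $ a1" for c1 c2 c3 a1 a2 a3
    by (simp add: matrix_matrix_mult_def[of "op23 ?R ** op12 ?R"] sum_triple 2 op23_entry delta_simps cong: if_cong)
       (simp add: matrix_matrix_mult_def[of F] sum_distrib_right sum_distrib_left mult_ac, rule sum.swap)
  obtain c1 a3 c3 a1 where nz: "(F ** F) $ c1 $ a3 \<noteq> 0" "(G ** G) $ c3 $ a1 \<noteq> 0"
    using nz by (auto simp: vec_eq_iff)
  have "(F ** G) $ c2 $ a2 = (G ** F) $ c2 $ a2" for c2 a2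
    using assms(1) 3[of c1 c2 c3 a1 a2 a3] 4[of c1 c2 c3 a1 a2 a3] nz
    unfolding yang_baxter_def by simp
  thus ?thesis by (simp add: vec_eq_iff)
qed

text \<open>
  Two equal nonzero pure tensors have proportional factors.
\<close>

lemma proportional_factors:
  fixes X X' :: "complex ^ 'n ^ 'm" and Y Y' :: "complex ^ 'k ^ 'l"
  assumes eq: "\<And>a b c d. X $ a $ b * Y $ c $ d = X' $ a $ b * Y' $ c $ d"
    and "X \<noteq> 0" "Y \<noteq> 0"
  obtains z where "X' = mat z ** X" "Y = mat z ** Y'"
proof -
  obtain a b c d where ab: "X $ a $ b \<noteq> 0" and cd: "Y $ c $ d \<noteq> 0" 
    using assms(2,3) by (auto simp: vec_eq_iff)
  define z where "z = X' $ a $ b / X $ a $ b"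
  have Y: "Y $ i $ j = z * Y' $ i $ j" for i j
    using eq[of a b i j] ab by (simp add: z_def field_simps)
  with cd have nz: "Y' $ c $ d \<noteq> 0" by auto
  have X: "X' $ i $ j = z * X $ i $ j" for i j
    using eq[of i j c d] nz unfolding Y by (simp add: mult_ac)
  from X Y show thesis by (intro that[of z]) (simp_all add: vec_eq_iff mat_mult_entry)
qed

text \<open>
  The consequences of the defining equations that the evaluation of the state sum rests on. The inverses of
  \<open>F\<close> and \<open>G\<close> have been replaced by \<open>lam F\<close> and \<open>mu G\<close>.
\<close>

locale swap_state_model =
  fixes Q :: "'n::finite state_model" and F G :: "complex ^ 'n ^ 'n" and lam mu :: complex
  assumes R_entry: "ent (R_op Q) a b c d = F $ c $ b * G $ d $ a"
    and Rbar_entry: "ent (Rbar_op Q) a b c d = mu * G $ c $ b * (lam * F $ d $ a)"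
    and cap_cup: "M_cap Q ** M_cup Q = mat 1"
    and cup_cap: "M_cup Q ** M_cap Q = mat 1"
    and F_square: "mat lam ** F ** F = mat 1"
    and G_square: "mat mu ** G ** G = mat 1"
    and eps_square: "(lam * mu) * (lam * mu) = 1"
    and FG_commute: "F ** G = G ** F"
    and F_cup: "transpose F ** M_cup Q = mat (lam * mu) ** M_cup Q ** F"
    and G_cup: "transpose G ** M_cup Q = mat (lam * mu) ** M_cup Q ** G"

text \<open>
  Written for a crossing of swap form, either slide equation for the minima is an equality of pure
  tensors: \<open>F \<otimes> G\<^sup>T N = F\<inverse> \<otimes> N G\<inverse>\<close> and \<open>G \<otimes> N F = G\<inverse> \<otimes> (F\<inverse>)\<^sup>T N\<close>. The factors are thus
  proportional, which defines \<open>lam\<close> and \<open>mu\<close>. Moving \<open>F\<^sup>2\<close>, a scalar matrix, past \<open>N\<close> in two ways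
  gives \<open>eps\<^sup>2 = 1\<close>.
\<close>

lemma swap_state_modelI:
  fixes Q :: "'n::finite state_model"
  assumes model: "unoriented_quantum_state_model Q"
    and inv: "invertible F" "invertible G"
    and R: "R_op Q = tensor_op F G ** swap_op"
  obtains lam mu where "swap_state_model Q F G lam mu"
proof -
  define N where "N = M_cup Q"
  define P where "P = M_cap Q"
  obtain Fi where Fi: "F ** Fi = mat 1" "Fi ** F = mat 1" using inv(1) by (auto simp: invertible_def)
  obtain Gi where Gi: "G ** Gi = mat 1" "Gi ** G = mat 1" using inv(2) by (auto simp: invertible_def)
  have PN: "P ** N = mat 1" and NP: "N ** P = mat 1"
    using model by (simp_all add: unoriented_quantum_state_model_def N_def P_def vec_eq_iff
      matrix_matrix_mult_def mat_def)
  have R_entry: "ent (R_op Q) a b c d = F $ c $ b * G $ d $ a" for a b c d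
    by (simp add: ent_def R swap_form_entry)
  have left: "(\<chi> x y. Gi $ fst x $ snd y * Fi $ snd x $ fst y) ** R_op Q = mat 1" (is "?B ** _ = _")
  proof -
    have "(?B ** R_op Q) $ (c, d) $ (a, b) = (Gi ** G) $ c $ a * (Fi ** F) $ d $ b" for a b c d
      by (simp add: R matrix_matrix_mult_def[of ?B] sum_pair swap_form_entry)
         (simp add: matrix_matrix_mult_def sum_product mult_ac)
    thus ?thesis by (auto simp: Fi Gi vec_eq_iff mat_def)
  qed
  have right: "R_op Q ** Rbar_op Q = mat 1"
  proof -
    have "(\<Sum>i\<in>UNIV. \<Sum>j\<in>UNIV. ent (Rbar_op Q) a b i j * ent (R_op Q) i j c d)
              = (if a = c \<and> b = d then 1 else 0)" for a b c d
      using model by (simp add: unoriented_quantum_state_model_def)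
    hence "(R_op Q ** Rbar_op Q) $ (c, d) $ (a, b) = (if a = c \<and> b = d then 1 else 0)" for a b c d
      by (simp add: matrix_matrix_mult_def sum_pair ent_def mult.commute)
    thus ?thesis by (auto simp: vec_eq_iff mat_def)
  qed
  have RB: "Rbar_op Q = ?B"
  proof -
    have "?B = ?B ** (R_op Q ** Rbar_op Q)" by (simp only: right matrix_mul_rid)
    also have "\<dots> = Rbar_op Q" by (simp only: left matrix_mul_assoc matrix_mul_lid)
    finally show ?thesis by simp
  qed
  have Rbar_entry: "ent (Rbar_op Q) a b c d = Gi $ c $ b * Fi $ d $ a" for a b c d
    by (simp add: ent_def RB)
  have inj: "X ** N \<noteq> 0" "N ** X \<noteq> 0" if "Y ** X = mat 1" "X ** Y = mat 1" for X Y
  proof -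
    have "Y ** (X ** N) ** P = (Y ** X) ** (N ** P)" "P ** (N ** X) ** Y = (P ** N) ** (X ** Y)"
      by (simp_all only: matrix_mul_assoc)
    hence "Y ** (X ** N) ** P = mat 1" "P ** (N ** X) ** Y = mat 1"
      by (simp_all only: that PN NP matrix_mul_lid)
    thus "X ** N \<noteq> 0" "N ** X \<noteq> 0" using mat_1_nonzero by auto
  qed
  have nz: "X \<noteq> 0" if "X ** Y = mat 1" for X Y :: "complex ^ 'n ^ 'n"
    using that mat_1_nonzero by auto
  have Tr: "transpose X ** transpose Y = mat 1" if "Y ** X = mat 1" for X Y :: "complex ^ 'n ^ 'n"
    using arg_cong[OF that, of transpose] by (simp add: matrix_transpose_mul transpose_mat)
  have slide: "slide_equations Q (R_op Q) (Rbar_op Q)" "slide_equations Q (Rbar_op Q) (R_op Q)"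
    using model by (simp_all add: unoriented_quantum_state_model_def)
  have e1: "F $ c $ a * (transpose G ** N) $ d $ b = Fi $ c $ a * (N ** Gi) $ d $ b" for a b c d
  proof -
    have "(\<Sum>i\<in>UNIV. N $ d $ i * ent (Rbar_op Q) a b i c) = (\<Sum>i\<in>UNIV. ent (R_op Q) d a c i * N $ i $ b)"
      using slide(1) by (simp add: slide_equations_def N_def)
    thus ?thesis
      by (simp add: R_entry Rbar_entry matrix_matrix_mult_def transpose_def sum_distrib_left mult_ac)
  qed
  obtain lam where lam: "Fi = mat lam ** F" "transpose G ** N = mat lam ** (N ** Gi)"
    using proportional_factors[of F "transpose G ** N" Fi "N ** Gi"] e1 nz[OF Fi(1)]
      inj(1)[OF Tr[OF Gi(1)] Tr[OF Gi(2)]] by metis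
  have e2: "G $ c $ a * (N ** F) $ d $ b = Gi $ c $ a * (transpose Fi ** N) $ d $ b" for a b c d
  proof -
    have "(\<Sum>i\<in>UNIV. N $ d $ i * ent (R_op Q) a b i c) = (\<Sum>i\<in>UNIV. ent (Rbar_op Q) d a c i * N $ i $ b)"
      using slide(2) by (simp add: slide_equations_def N_def)
    thus ?thesis
      by (simp add: R_entry Rbar_entry matrix_matrix_mult_def transpose_def sum_distrib_left mult_ac)
  qed
  obtain mu where mu: "Gi = mat mu ** G" "N ** F = mat mu ** (transpose Fi ** N)"
    using proportional_factors[of G "N ** F" Gi "transpose Fi ** N"] e2 nz[OF Gi(1)]
      inj(2)[OF Fi(2) Fi(1)] by metis
  define eps where "eps = lam * mu"
  have F2: "mat lam ** (F ** F) = mat 1" and G2: "mat mu ** (G ** G) = mat 1"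
    using Fi Gi lam mu by (simp_all add: matrix_mul_assoc)
  have GN: "transpose G ** N = mat eps ** (N ** G)"
    by (simp only: lam(2) mu(1) eps_def mat_left_commute[of N] mat_mat_left)
  have NF: "N ** F = mat eps ** (transpose F ** N)"
    by (simp only: mu(2) lam(1) eps_def matrix_transpose_mul transpose_mat mat_commute[of "transpose F"]
        mat_mat_left matrix_mul_assoc[symmetric] mult.commute[of lam])
  have "N = mat lam ** ((N ** F) ** F)"
    using arg_cong[OF F2, of "\<lambda>X. N ** X"]
    by (simp only: mat_left_commute[of N] matrix_mul_rid matrix_mul_assoc[symmetric])
  also have "\<dots> = mat lam ** (mat eps ** (transpose F ** (N ** F)))"
    by (simp only: NF matrix_mul_assoc[symmetric])
  also have "\<dots> = mat (eps * eps) ** (mat lam ** (transpose F ** transpose F) ** N)"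
    by (simp only: NF mat_left_commute[of "transpose F"] mat_mat_left matrix_mul_assoc[symmetric] mult_ac)
  also have "mat lam ** (transpose F ** transpose F) = mat 1"
    using arg_cong[OF F2, of transpose] by (simp add: matrix_transpose_mul transpose_mat mat_commute)
  finally have "N = mat (eps * eps) ** N" by simp
  hence "N ** P = (mat (eps * eps) ** N) ** P" by (rule arg_cong)
  hence "mat 1 = mat (eps * eps) ** (N ** P)"
    by (simp only: NP matrix_mul_assoc[symmetric])
  hence eps2: "eps * eps = 1" by (simp add: NP mat_inject)
  have FN: "transpose F ** N = mat eps ** (N ** F)"
    unfolding NF by (simp add: mat_mat_left eps2)
  have sq: "F ** F \<noteq> 0" "G ** G \<noteq> 0"
    using F2 G2 mat_1_nonzero by auto
  have FG: "F ** G = G ** F"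
    using model yang_baxter_swap_form[OF _ sq] by (simp add: unoriented_quantum_state_model_def R)
  show thesis
  proof (rule that, unfold_locales)
    show "ent (Rbar_op Q) a b c d = mu * G $ c $ b * (lam * F $ d $ a)" for a b c d
      by (simp add: Rbar_entry lam(1) mu(1) mat_mult_entry)
  qed (use R_entry PN NP F2 G2 eps2 FG FN GN in \<open>simp_all add: N_def P_def eps_def matrix_mul_assoc\<close>)
qed

context swap_state_model
begin

abbreviation N where "N \<equiv> M_cup Q"
abbreviation P where "P \<equiv> M_cap Q"
abbreviation eps where "eps \<equiv> lam * mu"

text \<open>
  \<open>T\<close> is picked up in a full clockwise turn (\<open>N\<^sup>T\<close> at the minimum, then \<open>P\<close> at the maximum) and
  its inverse \<open>T'\<close> in a full counterclockwise turn.
\<close>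

definition T where "T = P ** transpose N"
definition T' where "T' = transpose P ** N"

lemma transpose_PN: "transpose P ** transpose N = mat 1" "transpose N ** transpose P = mat 1"
  using arg_cong[OF cap_cup, of transpose] arg_cong[OF cup_cap, of transpose]
  by (simp_all add: matrix_transpose_mul transpose_mat)

lemma T_T': "T ** T' = mat 1" "T' ** T = mat 1"
proof -
  have "T ** T' = P ** (transpose N ** transpose P) ** N" "T' ** T = transpose P ** (N ** P) ** transpose N"
    by (simp_all add: T_def T'_def matrix_mul_assoc)
  thus "T ** T' = mat 1" "T' ** T = mat 1" by (simp_all add: transpose_PN cap_cup cup_cap)
qed

text \<open>
  Conjugation by \<open>N\<close> as well as by \<open>N\<^sup>T\<close> turns \<open>A\<close> into \<open>eps A\<^sup>T\<close>; in \<open>T\<close> and \<open>T'\<close> both occur, and the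
  factors \<open>eps\<close> cancel.
\<close>

lemma commute_T:
  assumes A: "transpose A ** N = mat eps ** N ** A"
  shows "A ** T = T ** A" "A ** T' = T' ** A"
proof -
  have "A ** P = mat (eps * eps) ** (A ** P)" by (simp add: eps_square)
  also have "\<dots> = mat eps ** (P ** (mat eps ** N ** A) ** P)"
    by (simp only: mat_left_commute[of P] mat_mat_left matrix_mul_assoc[symmetric])
       (simp add: matrix_mul_assoc cap_cup mult_ac)
  also have "\<dots> = mat eps ** P ** transpose A ** (N ** P)"
    by (simp only: A[symmetric] matrix_mul_assoc)
  finally have AP: "A ** P = mat eps ** P ** transpose A" by (simp add: cup_cap)
  have AN: "transpose A ** transpose N = mat eps ** (transpose N ** A)"
  proof -
    have "transpose N ** A = transpose (transpose A ** N)" by (simp add: matrix_transpose_mul)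
    also have "\<dots> = mat eps ** (transpose A ** transpose N)"
      by (simp only: A matrix_transpose_mul transpose_mat mat_commute matrix_mul_assoc mat_left_commute)
    finally have "mat eps ** (transpose N ** A) = mat (eps * eps) ** (transpose A ** transpose N)"
      by (simp only: mat_mat_left)
    thus ?thesis by (simp add: eps_square)
  qed
  have "A ** T = mat eps ** (P ** (transpose A ** transpose N))"
    unfolding T_def by (simp only: AP matrix_mul_assoc)
  also have "\<dots> = mat (eps * eps) ** (P ** (transpose N ** A))"
    by (simp only: AN mat_left_commute[of P] mat_mat_left)
  finally show AT: "A ** T = T ** A" by (simp add: eps_square T_def matrix_mul_assoc)
  have "A ** T' = (T' ** T) ** (A ** T')" by (simp add: T_T')
  also have "\<dots> = T' ** (T ** A) ** T'" by (simp only: matrix_mul_assoc)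
  also have "\<dots> = T' ** A ** (T ** T')" by (simp only: AT[symmetric] matrix_mul_assoc)
  finally show "A ** T' = T' ** A" by (simp add: T_T')
qed

lemmas FT = commute_T[OF F_cup] and GT = commute_T[OF G_cup]

text \<open>
  The normal form of a product of the commuting matrices that occur along a strand.
\<close>

definition word :: "complex \<Rightarrow> nat \<Rightarrow> nat \<Rightarrow> nat \<Rightarrow> nat \<Rightarrow> complex ^ 'n ^ 'n" where
  "word s f g t t' = mat s ** (mpow F f ** (mpow G g ** (mpow T t ** mpow T' t')))"

lemma exchange_product:
  fixes A B C E :: "complex ^ 'n ^ 'n"
  assumes "B ** C = C ** B"
  shows "(A ** B) ** (C ** E) = (A ** C) ** (B ** E)"
proof -
  have "(A ** B) ** (C ** E) = A ** (B ** C) ** E" by (simp only: matrix_mul_assoc)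
  also have "\<dots> = (A ** C) ** (B ** E)" by (simp only: assms matrix_mul_assoc)
  finally show ?thesis .
qed

lemma commute_mult:
  fixes A B C :: "complex ^ 'n ^ 'n"
  assumes "C ** A = A ** C" "C ** B = B ** C"
  shows "(A ** B) ** C = C ** (A ** B)"
proof -
  have "(A ** B) ** C = A ** (C ** B)" by (simp only: assms matrix_mul_assoc[symmetric])
  also have "\<dots> = C ** (A ** B)" by (simp only: assms(1)[symmetric] matrix_mul_assoc)
  finally show ?thesis .
qed

lemma word_mult: "word s f g t t' ** word s2 f2 g2 t2 t2' = word (s * s2) (f + f2) (g + g2) (t + t2) (t' + t2')"
proof -
  note c = mpow_commute[OF FG_commute] mpow_commute[OF FT(1)] mpow_commute[OF FT(2)]
    mpow_commute[OF GT(1)] mpow_commute[OF GT(2)]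
  have "mpow T' t' ** mpow T t2 = mpow T t2 ** mpow T' t'"
    by (rule mpow_commute) (simp add: T_T')
  note 1 = exchange_product[OF this, of "mpow T t" "mpow T' t2'"]
  have "(mpow T t ** mpow T' t') ** mpow G g2 = mpow G g2 ** (mpow T t ** mpow T' t')"
    by (intro commute_mult c)
  note 2 = exchange_product[OF this, of "mpow G g" "mpow T t2 ** mpow T' t2'"]
  have "(mpow G g ** (mpow T t ** mpow T' t')) ** mpow F f2 = mpow F f2 ** (mpow G g ** (mpow T t ** mpow T' t'))"
    by (rule commute_mult, rule c, rule commute_mult[symmetric]) (rule c)+
  note 3 = exchange_product[OF this, of "mpow F f" "mpow G g2 ** (mpow T t2 ** mpow T' t2')"]
  have "(mat s ** X) ** (mat s2 ** Y) = mat (s * s2) ** (X ** Y)" for X Y :: "complex ^ 'n ^ 'n"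
    by (simp only: mat_left_commute[of X] mat_mat_left matrix_mul_assoc[symmetric])
  thus ?thesis by (simp only: word_def mpow_add 1 2 3)
qed

end

section \<open>The state sum of a knot as a trace\<close>

primrec path_matrix :: "(nat \<Rightarrow> complex ^ 'n ^ 'n) \<Rightarrow> nat \<Rightarrow> complex ^ 'n ^ 'n" where
  "path_matrix W 0 = mat 1"
| "path_matrix W (Suc n) = path_matrix W n ** W n"

lemma sum_PiE_insert:
  fixes h :: "_ \<Rightarrow> 'b::comm_monoid_add"
  assumes "a \<notin> S"
  shows "(\<Sum>l\<in>insert a S \<rightarrow>\<^sub>E UNIV. h l) = (\<Sum>l\<in>S \<rightarrow>\<^sub>E UNIV. \<Sum>c\<in>UNIV. h (l(a := c)))"
proof -
  have "(\<Sum>l\<in>insert a S \<rightarrow>\<^sub>E UNIV. h l) = (\<Sum>(c, l)\<in>UNIV \<times> (S \<rightarrow>\<^sub>E UNIV). h (l(a := c)))"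
    unfolding PiE_insert_eq
    by (subst sum.reindex[OF inj_combinator[OF assms]]) (simp add: case_prod_unfold)
  also have "\<dots> = (\<Sum>c\<in>UNIV. \<Sum>l\<in>S \<rightarrow>\<^sub>E UNIV. h (l(a := c)))" by (simp add: sum.cartesian_product)
  finally show ?thesis by (simp add: sum.swap[of _ UNIV])
qed

text \<open>
  The entries of a product of matrices are sums over paths of indices. The matrix \<open>V\<close> closes the path
  to a cycle; that it is arbitrary lets the induction absorb the last step into it.
\<close>

lemma path_sum:
  fixes x :: "nat \<Rightarrow> 'p" and V :: "complex ^ 'n::finite ^ 'n"
  assumes "inj_on x {..n}"
  shows "(\<Sum>l\<in>x ` {..n} \<rightarrow>\<^sub>E UNIV. (\<Prod>j<n. W j $ l (x j) $ l (x (Suc j))) * V $ l (x n) $ l (x 0))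
    = trace (path_matrix W n ** V)"
  using assms
proof (induction n arbitrary: V)
  case 0
  show ?case by (simp add: sum_PiE_insert trace_def)
next
  case (Suc n)
  have new: "x (Suc n) \<notin> x ` {..n}" and inj: "inj_on x {..n}"
    using Suc.prems by (simp_all add: atMost_Suc)
  have ne: "x j \<noteq> x (Suc n)" if "j \<le> n" for j using new that by (metis atMost_iff image_eqI)
  have "(\<Sum>l\<in>x ` {..Suc n} \<rightarrow>\<^sub>E UNIV. (\<Prod>j<Suc n. W j $ l (x j) $ l (x (Suc j))) * V $ l (x (Suc n)) $ l (x 0))
    = (\<Sum>l\<in>x ` {..n} \<rightarrow>\<^sub>E UNIV. \<Sum>c\<in>UNIV. (\<Prod>j<n. W j $ l (x j) $ l (x (Suc j))) * W n $ l (x n) $ c * V $ c $ l (x 0))"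
    unfolding atMost_Suc image_insert sum_PiE_insert[OF new] by (simp add: ne)
  also have "\<dots> = (\<Sum>l\<in>x ` {..n} \<rightarrow>\<^sub>E UNIV. (\<Prod>j<n. W j $ l (x j) $ l (x (Suc j))) * (W n ** V) $ l (x n) $ l (x 0))"
    by (simp add: matrix_matrix_mult_def sum_distrib_left mult.assoc)
  also have "\<dots> = trace (path_matrix W n ** (W n ** V))"
    by (rule Suc.IH[OF inj])
  finally show ?case by (simp add: matrix_mul_assoc)
qed

locale swap_state_sum = swap_state_model Q F G lam mu + oriented_diagram D down
  for Q :: "'n::finite state_model" and F G lam mu D down
begin

text \<open>
  The factor contributed by the step from \<open>x\<close> to \<open>succ x\<close>, with rows indexed by the label of \<open>x\<close> and
  columns by that of \<open>succ x\<close>. Operators map upper labels to lower ones as column vectors, whence the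
  transposes on downward strands.
\<close>

definition transport :: "point \<Rightarrow> complex ^ 'n ^ 'n" where
  "transport x = (case place x of
      None \<Rightarrow> mat 1
    | Some (Cup, left) \<Rightarrow> if left then N else transpose N
    | Some (Cap, left) \<Rightarrow> if left then P else transpose P
    | Some (Over, left) \<Rightarrow> if down x then transpose (if left then G else F) else (if left then F else G)
    | Some (Under, left) \<Rightarrow> if down x then transpose (if left then mat lam ** F else mat mu ** G)
                                 else (if left then mat mu ** G else mat lam ** F))"

text \<open>
  The exponents and the scalar of the factor of a step after the change of basis \<open>gauge\<close>. At
  a crossing the overcrossing strand counts for \<open>G\<close> and the undercrossing one for \<open>F\<close>; which of the two
  is met depends on the type of the crossing, the direction and the end at which it is entered.
\<close>

definition scale :: "point \<Rightarrow> complex" where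
  "scale x = (case place x of
      Some (Over, left) \<Rightarrow> if down x then eps else 1
    | Some (Under, left) \<Rightarrow> if down x then eps * (if left then lam else mu) else (if left then mu else lam)
    | _ \<Rightarrow> 1)"

definition F_count :: "point \<Rightarrow> nat" where
  "F_count x = (case place x of Some (Over, left) \<Rightarrow> of_bool (down x \<noteq> left)
     | Some (Under, left) \<Rightarrow> of_bool (down x = left) | _ \<Rightarrow> 0)"

definition G_count :: "point \<Rightarrow> nat" where
  "G_count x = (case place x of Some (Over, left) \<Rightarrow> of_bool (down x = left)
     | Some (Under, left) \<Rightarrow> of_bool (down x \<noteq> left) | _ \<Rightarrow> 0)"

definition T_count :: "point \<Rightarrow> nat" where
  "T_count x = of_bool (place x = Some (Cup, False))"

definition T'_count :: "point \<Rightarrow> nat" where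
  "T'_count x = of_bool (place x = Some (Cap, False))"

text \<open>
  Downward strands are read through \<open>N\<close>, after which both directions multiply by \<open>F\<close> and \<open>G\<close>
  instead of their transposes.
\<close>

definition gauge :: "point \<Rightarrow> complex ^ 'n ^ 'n" where
  "gauge x = (if down x then N else mat 1)"

abbreviation bead :: "point \<Rightarrow> complex ^ 'n ^ 'n" where
  "bead x \<equiv> word (scale x) (F_count x) (G_count x) (T_count x) (T'_count x)"

lemmas bead_defs = scale_def F_count_def G_count_def T_count_def T'_count_def

lemma cup_T: "N ** T = transpose N" "N ** P ** X = X"
  by (simp_all add: T_def matrix_mul_assoc cup_cap)

text \<open>
  The point where the relations of the model enter: in the new bases every step contributes an element
  of the commuting family.
\<close>

lemma transport_gauge:
  assumes x: "x \<in> points D"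
  shows "transport x ** gauge (succ x) = gauge x ** bead x"
proof (cases "place x")
  case None
  with down_succ[OF x] show ?thesis
    by (simp add: transport_def gauge_def bead_defs word_def)
next
  case (Some q)
  then obtain p left where pl: "place x = Some (p, left)" by (cases q) auto
  show ?thesis
  proof (cases p)
    case Cup
    with pl down_succ[OF x] show ?thesis
      by (simp add: transport_def gauge_def bead_defs word_def cup_T)
  next
    case Cap
    with pl down_succ[OF x] show ?thesis
      by (simp add: transport_def gauge_def bead_defs word_def cap_cup T'_def)
  next
    case Over
    with pl down_succ[OF x] show ?thesis
      by (simp add: transport_def gauge_def bead_defs word_def F_cup G_cup mat_left_commute[of N] 
          matrix_mul_assoc[symmetric])
  next
    case Under
    have "transpose (mat z ** A) ** N = N ** (mat (eps * z) ** A)"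
      if A: "transpose A ** N = mat eps ** N ** A" for z A
    proof -
      have "transpose (mat z ** A) ** N = mat z ** (transpose A ** N)"
        by (simp only: matrix_transpose_mul transpose_mat mat_commute matrix_mul_assoc)
      also have "\<dots> = N ** (mat (eps * z) ** A)"
        by (simp only: A mat_left_commute[of N] mat_mat_left matrix_mul_assoc[symmetric] mult.commute[of z])
      finally show ?thesis .
    qed
    note this[OF F_cup, of lam] this[OF G_cup, of mu]
    with Under pl down_succ[OF x] show ?thesis
      by (cases "down x"; cases left) (simp_all add: transport_def gauge_def bead_defs word_def)
  qed
qed

lemma prod_agree: "finite A \<Longrightarrow> (\<Prod>x\<in>A. if ok x then 1 else 0) = (if \<forall>x\<in>A. ok x then 1 else (0::complex))"
  by (induction A rule: finite_induct) auto

lemma distinct_ends: "(if a then (k, i) else (Suc k, Suc i)) \<noteq> (if b then (k, Suc i) else (Suc k, i))"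
  for k i :: nat by auto

lemma piece_weight:
  assumes k: "k < length D"
  shows "(\<Prod>x\<in>piece_starts k. transport x $ l x $ l (succ x)) = weight Q D l k"
proof -
  obtain p i where D: "D ! k = (p, i)" by force
  consider "p = Cup" | "p = Cap" | "p = Over \<or> p = Under" by (cases p) auto
  thus ?thesis
  proof cases
    case 1
    note D' = D[unfolded 1]
    show ?thesis using piece_starts_cup[OF k D'] place_cup[OF k D'] succ_cup[OF k D']
      by (cases "down (k, i)") (simp_all add: weight_def D' transport_def transpose_def)
  next
    case 2
    note D' = D[unfolded 2]
    show ?thesis using piece_starts_cap[OF k D'] place_cap[OF k D'] succ_cap[OF k D']
      by (cases "down (Suc k, i)") (simp_all add: weight_def D' transport_def transpose_def)
  next
    case 3
    have prod: "(\<Prod>x\<in>piece_starts k. h x) = h (if down (k, i) then (k, i) else (Suc k, Suc i)) *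
        h (if down (k, Suc i) then (k, Suc i) else (Suc k, i))" for h :: "point \<Rightarrow> complex"
      unfolding piece_starts_crossing[OF k D 3] using distinct_ends by simp
    note facts = place_crossing[OF k D 3] succ_crossing[OF k D 3] down_crossing[OF k D 3]
    from 3 show ?thesis unfolding prod using facts
      by (cases "down (k, i)"; cases "down (k, Suc i)"; elim disjE)
         (simp_all add: weight_def D transport_def transpose_def R_entry Rbar_entry mat_mult_entry mult_ac)
  qed
qed

lemma slice_weight:
  assumes k: "k < length D"
  shows "(\<Prod>x\<in>starts k. transport x $ l x $ l (succ x)) =
    (if constant_beside k l then weight Q D l k else 0)"
proof -
  have sub: "piece_starts k \<subseteq> starts k" by (auto simp: piece_starts_def)
  have "transport x = mat 1" if "x \<in> starts k - piece_starts k" for x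
  proof -
    have "place x = None" using that unfolding piece_starts_def by blast
    thus ?thesis by (simp add: transport_def)
  qed
  hence "(\<Prod>x\<in>starts k - piece_starts k. transport x $ l x $ l (succ x)) =
      (\<Prod>x\<in>starts k - piece_starts k. if l x = l (succ x) then 1 else 0)"
    by (intro prod.cong) (auto simp: mat_def)
  thus ?thesis
    unfolding prod.subset_diff[OF sub finite_starts] piece_weight[OF k]
    by (simp add: prod_agree finite_starts constant_beside_iff)
qed

text \<open>
  The labels of a labelling are free at every point once the constraint on vertical strands is moved into
  the summand, where it is the product of the entries of identity matrices.
\<close>

lemma Invar_transport:
  "Invar Q D = (\<Sum>l\<in>points D \<rightarrow>\<^sub>E UNIV. \<Prod>x\<in>points D. transport x $ l x $ l (succ x))"
proof -
  let ?A = "points D \<rightarrow>\<^sub>E (UNIV :: 'n set)"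
  have "(\<Prod>x\<in>points D. transport x $ l x $ l (succ x)) =
      (if \<forall>(x, y)\<in>verticals D. l x = l y then \<Prod>k<length D. weight Q D l k else 0)" (is "?l = ?r") for l
  proof -
    have "?l = (\<Prod>k<length D. if constant_beside k l then weight Q D l k else 0)"
      unfolding prod_points by (intro prod.cong) (simp_all add: slice_weight)
    also have "\<dots> = ?r"
    proof (cases "\<forall>(x, y)\<in>verticals D. l x = l y")
      case True
      hence "constant_beside k l" for k unfolding constant_beside_def by blast
      with True show ?thesis by simp
    next
      case False
      then obtain x y where xy: "(x, y) \<in> verticals D" "l x \<noteq> l y" by blast
      hence "fst x < length D" by (auto simp: verticals_def)
      moreover have "\<not> constant_beside (fst x) l" using xy unfolding constant_beside_def by blast
      ultimately have "\<exists>k\<in>{..<length D}. (if constant_beside k l then weight Q D l k else 0) = 0"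
        by (intro bexI[of _ "fst x"]) simp_all
      with False show ?thesis by (simp only: if_False prod_zero finite_lessThan)
    qed
    finally show ?thesis .
  qed
  moreover have "finite ?A" by (intro finite_PiE finite_points) auto
  ultimately show ?thesis
    by (simp add: Invar_def labellings_def sum.inter_filter[symmetric] cong: conj_cong)
qed

text \<open>
  The changes of basis telescope along the strand.
\<close>

lemma path_matrix_gauge:
  assumes "x0 \<in> points D"
  shows "path_matrix (\<lambda>j. transport ((succ ^^ j) x0)) m ** gauge ((succ ^^ m) x0) =
    gauge x0 ** word (\<Prod>j<m. scale ((succ ^^ j) x0)) (\<Sum>j<m. F_count ((succ ^^ j) x0))
      (\<Sum>j<m. G_count ((succ ^^ j) x0)) (\<Sum>j<m. T_count ((succ ^^ j) x0)) (\<Sum>j<m. T'_count ((succ ^^ j) x0))"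
proof (induction m)
  case 0
  show ?case by (simp add: word_def)
next
  case (Suc m)
  have x: "(succ ^^ m) x0 \<in> points D" by (induction m) (simp_all add: assms succ_in_points)
  show ?case
    using transport_gauge[OF x] Suc
    by (simp add: matrix_mul_assoc[symmetric]) (simp add: matrix_mul_assoc word_mult[symmetric])
qed

text \<open>
  The points form a single cycle of \<open>succ\<close>, so the state sum is the trace of the product of all
  transports along it. The change of basis at the starting point disappears by the cyclic
  invariance of the trace.
\<close>

lemma Invar_trace:
  assumes x0: "x0 \<in> points D"
    and conn: "\<And>y. y \<in> points D \<Longrightarrow> (x0, y) \<in> (strand_steps D \<union> (strand_steps D)\<inverse>)\<^sup>*"
  shows "Invar Q D = trace (word (\<Prod>x\<in>points D. scale x) (\<Sum>x\<in>points D. F_count x)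
    (\<Sum>x\<in>points D. G_count x) (\<Sum>x\<in>points D. T_count x) (\<Sum>x\<in>points D. T'_count x))"
proof -
  have orb: "orbit succ x0 = points D" "x0 \<in> orbit succ x0"
    using orbit_eq_points[OF x0] conn by blast+
  define n where "n = funpow_dist succ (succ x0) x0"
  define x where "x j = (succ ^^ j) x0" for j
  have x_0: "x 0 = x0" and x_Suc: "x (Suc j) = succ (x j)" for j by (simp_all add: x_def)
  have x_n: "x (Suc n) = x0"
    using funpow_dist1_prop[OF orb(2)] by (simp add: x_def n_def)
  have ivl: "{0..<Suc n} = {..n}" by auto
  have inj: "inj_on x {..n}"
    using inj_on_funpow_dist1[OF orb(2)] unfolding x_def[abs_def] n_def[symmetric] ivl .
  have img: "points D = x ` {..n}"
    using orbit_conv_funpow_dist1[OF orb(2)] unfolding orb(1) x_def[abs_def] n_def[symmetric] ivl .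
  have prod_x: "(\<Prod>y\<in>points D. h y) = (\<Prod>j<Suc n. h (x j))" for h :: "point \<Rightarrow> complex"
    unfolding img by (simp add: prod.reindex[OF inj] lessThan_Suc_atMost)
  have sum_x: "(\<Sum>y\<in>points D. h y) = (\<Sum>j<Suc n. h (x j))" for h :: "point \<Rightarrow> nat"
    unfolding img by (simp add: sum.reindex[OF inj] lessThan_Suc_atMost)
  let ?M = "path_matrix (\<lambda>j. transport (x j)) (Suc n)"
  let ?Z = "word (\<Prod>x\<in>points D. scale x) (\<Sum>x\<in>points D. F_count x)
    (\<Sum>x\<in>points D. G_count x) (\<Sum>x\<in>points D. T_count x) (\<Sum>x\<in>points D. T'_count x)"
  have "Invar Q D = (\<Sum>l\<in>x ` {..n} \<rightarrow>\<^sub>E UNIV. (\<Prod>j<n. transport (x j) $ l (x j) $ l (x (Suc j))) *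
      transport (x n) $ l (x n) $ l (x 0))"
    unfolding Invar_transport prod_x by (simp add: img x_Suc[symmetric] x_n x_0 del: x_Suc)
  also have "\<dots> = trace ?M"
    by (simp add: path_sum[OF inj])
  also have "?M ** gauge x0 = gauge x0 ** ?Z"
    using path_matrix_gauge[OF x0, of "Suc n"] x_n unfolding prod_x sum_x x_def by simp
  hence "trace ?M = trace ?Z"
  proof -
    obtain g' where g: "gauge x0 ** g' = mat 1" "g' ** gauge x0 = mat 1"
      by (cases "down x0") (auto simp: gauge_def intro: that cup_cap cap_cup)
    have "trace ?M = trace (?M ** gauge x0 ** g')" by (simp only: g matrix_mul_assoc[symmetric] matrix_mul_rid)
    also have "\<dots> = trace (g' ** (gauge x0 ** ?Z))"
      using \<open>?M ** gauge x0 = gauge x0 ** ?Z\<close> by (simp only: trace_mul_sym[of _ g'])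
    also have "\<dots> = trace ?Z" by (simp only: g matrix_mul_assoc matrix_mul_lid)
    finally show ?thesis .
  qed
  finally show ?thesis .
qed

end

context oriented_diagram
begin

definition positive :: nat where
  "positive = (\<Sum>k<length D. of_bool (crossing_sign D down k = 1))"

definition negative :: nat where
  "negative = (\<Sum>k<length D. of_bool (crossing_sign D down k = -1))"

lemma writhe_eq: "writhe D down = int positive - int negative"
proof -
  have "crossing_sign D down k = of_bool (crossing_sign D down k = 1) - of_bool (crossing_sign D down k = -1)" for k
    by (auto simp: crossing_sign_def split: prod.splits piece.splits)
  hence "writhe D down = (\<Sum>k<length D. of_bool (crossing_sign D down k = 1) - of_bool (crossing_sign D down k = -1))"
    unfolding writhe_def by (rule sum.cong[OF refl])
  thus ?thesis by (simp only: positive_def negative_def sum_subtractf of_nat_sum of_nat_of_bool)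
qed

end

context swap_state_sum
begin

text \<open>
  The two strands of a crossing together contribute \<open>lam mu\<close> or 1 from the inverses, and
  \<open>eps\<close> for each strand that points down; in total this is \<open>eps\<close> at positive and 1 at negative
  crossings.
\<close>

lemma starts_counts:
  assumes k: "k < length D"
  shows "(\<Prod>x\<in>starts k. scale x) = (if crossing_sign D down k = 1 then eps else 1)"
    "(\<Sum>x\<in>starts k. F_count x) = of_bool (crossing_sign D down k = 1) + of_bool (crossing_sign D down k = -1)"
    "(\<Sum>x\<in>starts k. G_count x) = of_bool (crossing_sign D down k = 1) + of_bool (crossing_sign D down k = -1)"
    "turning_angle D down k = 2 * pi * (real (\<Sum>x\<in>starts k. T'_count x) - real (\<Sum>x\<in>starts k. T_count x))
       - pi * (of_bool (fst (D ! k) = Cap) - of_bool (fst (D ! k) = Cup))"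
proof -
  obtain p i where D: "D ! k = (p, i)" by force
  have s: "prod scale (starts k) = prod scale (piece_starts k)"
     "sum F_count (starts k) = sum F_count (piece_starts k)"
     "sum G_count (starts k) = sum G_count (piece_starts k)"
     "sum T_count (starts k) = sum T_count (piece_starts k)"
     "sum T'_count (starts k) = sum T'_count (piece_starts k)"
    by (auto intro!: prod_starts sum_starts simp: bead_defs)
  have "prod scale (starts k) = (if crossing_sign D down k = 1 then eps else 1) \<and>
    sum F_count (starts k) = of_bool (crossing_sign D down k = 1) + of_bool (crossing_sign D down k = -1) \<and>
    sum G_count (starts k) = of_bool (crossing_sign D down k = 1) + of_bool (crossing_sign D down k = -1) \<and>
    turning_angle D down k = 2 * pi * (real (\<Sum>x\<in>starts k. T'_count x) - real (\<Sum>x\<in>starts k. T_count x))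
       - pi * (of_bool (fst (D ! k) = Cap) - of_bool (fst (D ! k) = Cup))"
  proof -
    consider "p = Cup" | "p = Cap" | "p = Over \<or> p = Under" by (cases p) auto
    thus ?thesis
    proof cases
      case 1
      note D' = D[unfolded 1]
      show ?thesis unfolding s using piece_starts_cup[OF k D'] place_cup[OF k D']
        by (cases "down (k, i)") (simp_all add: crossing_sign_def turning_angle_def D' bead_defs)
    next
      case 2
      note D' = D[unfolded 2]
      show ?thesis unfolding s using piece_starts_cap[OF k D'] place_cap[OF k D']
        by (cases "down (Suc k, i)") (simp_all add: crossing_sign_def turning_angle_def D' bead_defs)
    next
      case 3
      have prod: "(\<Prod>x\<in>piece_starts k. h x) = h (if down (k, i) then (k, i) else (Suc k, Suc i)) *
          h (if down (k, Suc i) then (k, Suc i) else (Suc k, i))" for h :: "point \<Rightarrow> complex"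
        unfolding piece_starts_crossing[OF k D 3] using distinct_ends by simp
      have sum: "(\<Sum>x\<in>piece_starts k. h x) = h (if down (k, i) then (k, i) else (Suc k, Suc i)) +
          h (if down (k, Suc i) then (k, Suc i) else (Suc k, i))" for h :: "point \<Rightarrow> nat"
        unfolding piece_starts_crossing[OF k D 3] using distinct_ends by simp
      note facts = place_crossing[OF k D 3] down_crossing[OF k D 3]
      have e: "lam * (lam * (mu * mu)) = 1" using eps_square by (simp add: mult_ac)
      have e': "lam * (lam * (mu * (mu * z))) = z" for z
        using arg_cong[OF e, of "\<lambda>w. w * z"] by (simp add: mult_ac)
      from 3 show ?thesis unfolding s prod sum using facts
        by (cases "down (k, i)"; cases "down (k, Suc i)"; elim disjE)
           (simp_all add: crossing_sign_def turning_angle_def D bead_defs mult_ac e e')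
    qed
  qed
  thus "(\<Prod>x\<in>starts k. scale x) = (if crossing_sign D down k = 1 then eps else 1)"
    "(\<Sum>x\<in>starts k. F_count x) = of_bool (crossing_sign D down k = 1) + of_bool (crossing_sign D down k = -1)"
    "(\<Sum>x\<in>starts k. G_count x) = of_bool (crossing_sign D down k = 1) + of_bool (crossing_sign D down k = -1)"
    "turning_angle D down k = 2 * pi * (real (\<Sum>x\<in>starts k. T'_count x) - real (\<Sum>x\<in>starts k. T_count x))
       - pi * (of_bool (fst (D ! k) = Cap) - of_bool (fst (D ! k) = Cup))" by simp_all
qed

lemma points_counts:
  "(\<Prod>x\<in>points D. scale x) = eps ^ positive"
  "(\<Sum>x\<in>points D. F_count x) = positive + negative"
  "(\<Sum>x\<in>points D. G_count x) = positive + negative"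
  "whitney_degree D down = real (\<Sum>x\<in>points D. T'_count x) - real (\<Sum>x\<in>points D. T_count x)"
proof -
  have "(\<Prod>x\<in>points D. scale x) = (\<Prod>k<length D. eps ^ of_bool (crossing_sign D down k = 1))"
    unfolding prod_points by (intro prod.cong) (simp_all add: starts_counts)
  thus "(\<Prod>x\<in>points D. scale x) = eps ^ positive"
    by (simp only: positive_def power_sum)
  show "(\<Sum>x\<in>points D. F_count x) = positive + negative" "(\<Sum>x\<in>points D. G_count x) = positive + negative"
    unfolding sum_points positive_def negative_def by (simp_all add: starts_counts sum.distrib)
  have "(\<Sum>k<length D. turning_angle D down k) =
     (\<Sum>k<length D. 2 * pi * (real (\<Sum>x\<in>starts k. T'_count x) - real (\<Sum>x\<in>starts k. T_count x))
     - pi * (of_bool (fst (D ! k) = Cap) - of_bool (fst (D ! k) = Cup)))"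
    by (intro sum.cong) (simp_all only: starts_counts(4) lessThan_iff)
  also have "\<dots> =
     2 * pi * (\<Sum>k<length D. real (\<Sum>x\<in>starts k. T'_count x) - real (\<Sum>x\<in>starts k. T_count x))
     - pi * (\<Sum>k<length D. of_bool (fst (D ! k) = Cap) - of_bool (fst (D ! k) = Cup))"
    by (simp only: sum_subtractf[of "\<lambda>k. 2 * pi * _ k"] sum_distrib_left)
  finally have "(\<Sum>k<length D. turning_angle D down k) =
     2 * pi * (\<Sum>k<length D. real (\<Sum>x\<in>starts k. T'_count x) - real (\<Sum>x\<in>starts k. T_count x))"
    unfolding cups_eq_caps by simp
  thus "whitney_degree D down = real (\<Sum>x\<in>points D. T'_count x) - real (\<Sum>x\<in>points D. T_count x)"
    unfolding whitney_degree_def by (simp add: sum_points sum_subtractf)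
qed

lemma Invar_formula:
  assumes "x0 \<in> points D"
    and "\<And>y. y \<in> points D \<Longrightarrow> (x0, y) \<in> (strand_steps D \<union> (strand_steps D)\<inverse>)\<^sup>*"
  obtains t t' where "whitney_degree D down = real t' - real t"
    and "Invar Q D = trace (mpow (mat eps ** (F ** G)) positive ** mpow (F ** G) negative
           ** (mpow T t ** mpow T' t'))"
proof -
  have "word (eps ^ positive) (positive + negative) (positive + negative) t t' =
     mpow (mat eps ** (F ** G)) positive ** mpow (F ** G) negative ** (mpow T t ** mpow T' t')" for t t'
  proof -
    have "word (eps ^ positive) (positive + negative) (positive + negative) t t' =
      mat (eps ^ positive) ** mpow (F ** G) (positive + negative) ** (mpow T t ** mpow T' t')"
      by (simp only: word_def mpow_mult[OF FG_commute] matrix_mul_assoc)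
    also have "mat (eps ^ positive) ** mpow (F ** G) (positive + negative)
       = mpow (mat eps ** (F ** G)) positive ** mpow (F ** G) negative"
      using mpow_mult[OF mat_commute[symmetric], of eps "F ** G" positive]
      by (simp only: mpow_add mpow_mat matrix_mul_assoc[of "mat (eps ^ positive)"])
    finally show ?thesis .
  qed
  with that points_counts Invar_trace[OF assms] show thesis by metis
qed

end

text \<open>
  The contributions of a positive and of a negative crossing cancel.
\<close>

lemma (in swap_state_model) FG_inverse: "(mat eps ** (F ** G)) ** (F ** G) = mat 1"
proof -
  have "(mat eps ** (F ** G)) ** (F ** G) = mat lam ** (mat mu ** (F ** (G ** F) ** G))"
    by (simp only: mat_mat_left matrix_mul_assoc[symmetric])
  also have "\<dots> = mat lam ** F ** F ** (mat mu ** G ** G)"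
    by (simp only: FG_commute[symmetric] matrix_mul_assoc[symmetric] mat_left_commute[of F])
  finally show ?thesis by (simp add: F_square G_square)
qed

lemma (in swap_state_model) Invar_connected_eq:
  assumes "oriented_diagram K down_K" "oriented_diagram U down_U"
    and "connected_diagram K" "connected_diagram U"
    and w: "writhe K down_K = writhe U down_U" and d: "whitney_degree K down_K = whitney_degree U down_U"
  shows "Invar Q K = Invar Q U"
proof -
  interpret K: swap_state_sum Q F G lam mu K down_K
    using swap_state_model_axioms assms(1) by (rule swap_state_sum.intro)
  interpret U: swap_state_sum Q F G lam mu U down_U
    using swap_state_model_axioms assms(2) by (rule swap_state_sum.intro)
  obtain t t' where K: "whitney_degree K down_K = real t' - real t"
    "Invar Q K = trace (mpow (mat eps ** (F ** G)) K.positive ** mpow (F ** G) K.negative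
           ** (mpow T t ** mpow T' t'))"
    using assms(3) K.Invar_formula unfolding connected_diagram_def by metis
  obtain u u' where U: "whitney_degree U down_U = real u' - real u"
    "Invar Q U = trace (mpow (mat eps ** (F ** G)) U.positive ** mpow (F ** G) U.negative
           ** (mpow T u ** mpow T' u'))"
    using assms(4) U.Invar_formula unfolding connected_diagram_def by metis
  have "K.positive + U.negative = U.positive + K.negative"
    using w unfolding K.writhe_eq U.writhe_eq by linarith
  note 1 = mpow_balance[OF FG_inverse this]
  have "t + u' = u + t'" using d unfolding K(1) U(1) by linarith
  note 2 = mpow_balance[OF T_T'(1) this]
  show ?thesis unfolding K(2) U(2) 1 2 ..
qed

theorem mainTheorem2:
  fixes Q :: "'n::finite state_model"
    and F G :: "complex ^ 'n ^ 'n"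
    and K U :: diagram
    and down_K down_U :: "point \<Rightarrow> bool"
  assumes "unoriented_quantum_state_model Q"
    and "invertible F" and "invertible G"
    and "R_op Q = tensor_op F G ** swap_op"
    and "knot_diagram K"
    and "unknot_diagram U"
    and "orientation K down_K" and "orientation U down_U"
    and "writhe K down_K = writhe U down_U"
    and "whitney_degree K down_K = whitney_degree U down_U"
  shows "Invar Q K = Invar Q U"
proof -
  obtain lam mu where "swap_state_model Q F G lam mu"
    by (rule swap_state_modelI[OF assms(1-4)])
  then interpret swap_state_model Q F G lam mu .
  have K: "oriented_diagram K down_K"
    using assms(5,7) by (simp add: oriented_diagram_def knot_diagram_def)
  have U: "oriented_diagram U down_U"
    using assms(6,8) by (simp add: oriented_diagram_def unknot_diagram_def)
  show ?thesis
    by (rule Invar_connected_eq[OF K U knot_diagram_connected[OF assms(5)]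
          oriented_diagram.unknot_connected[OF U assms(6)] assms(9,10)])
qed

end
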